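(* Let $d\ge 3$ and let $p\colon S^{d-1}\to(0,\infty)$ be a Borel measurable function with $Z:=\int_{S^{d-1}}p\,d\sigma_{d-1}\in(0,\infty)$, and let $\pi(dx)=\frac1Z p(x)\,\sigma_{d-1}(dx)$. Assume there is a Borel set $C\subseteq S^{d-1}$ with $\sigma_{d-1}(C)>0$ such that $$0<\inf_{x\in C}p(x)\quad\text{and}\quad \sup_{x\in S^{d-1}}p(x)<\infty .$$ Set $\beta:=\frac{\inf_{y\in C}p(y)}{\sup_{y\in S^{d-1}}p(y)}\in(0,1]$ and $\rho:=1-\frac{\beta}{2\pi}\frac{\sigma_{d-1}(C)}{\omega_{d-2}}$. Then $\rho\in(0,1)$ and the ideal geodesic slice sampling kernel $H$ satisfies $$\sup_{x\in S^{d-1}} d_{TV}\big(H^n(x,\cdot),\pi\big)\le \rho^n\qquad\text{for all } n\in\mathbb N.$$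
   Context: $S^{d-1}=\{x\in\mathbb R^d:\|x\|=1\}$ with its Borel $\sigma$-algebra; $\sigma_{d-1}$ is the canonical volume (surface) measure on $S^{d-1}$, and $\omega_{d-1}:=\sigma_{d-1}(S^{d-1})$ (so $\omega_{d-2}$ is the volume of $S^{d-2}$). For $x\in S^{d-1}$, $S^{d-2}_x:=\{v\in S^{d-1}:\langle v,x\rangle=0\}$, and $\mu_x$ is the natural volume measure on $S^{d-2}_x$, i.e. the image of $\sigma_{d-2}$ under any linear isometry $\varphi_x\colon\mathbb R^{d-1}\to\{y:\langle y,x\rangle=0\}$ (so $\mu_x(S^{d-2}_x)=\omega_{d-2}$). For $x\in S^{d-1},v\in S^{d-2}_x$, $\gamma_{(x,v)}(\theta):=\cos(\theta)x+\sin(\theta)v$. For $x\in S^{d-1}$, $v\in S^{d-2}_x$, $t>0$, the geodesic level set is $L(x,v,t):=\{\theta\in[0,2\pi): p(\gamma_{(x,v)}(\theta))>t\}$; $\lambda_1$ denotes Lebesgue measure on $\mathbb R$. The kernel $H$ is defined by $$H(x,A):=\frac{1}{p(x)}\int_0^{p(x)}\frac{1}{\omega_{d-2}}\int_{S^{d-2}_x}\frac{1}{\lambda_1(L(x,v,t))}\int_{L(x,v,t)}\mathbb 1_A(\gamma_{(x,v)}(\theta))\,d\theta\,\mu_x(dv)\,dt$$ for those $x$ for which this is well defined (this holds for $\sigma_{d-1}$-almost every $x$), and $H(x,\cdot):=\frac{1}{\omega_{d-1}}\sigma_{d-1}$ for the remaining $x$. Algorithmically: draw $v$ uniformly on $S^{d-2}_x$,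 draw $t\sim\mathcal U(0,p(x))$, then draw $\theta$ uniformly on $[0,2\pi)$ repeatedly until $p(\gamma_{(x,v)}(\theta))>t$ and output $\gamma_{(x,v)}(\theta)$. $d_{TV}(\mu,\nu)=\sup_A|\mu(A)-\nu(A)|$ is the total variation distance. *)

theory Defs
  imports "HOL-Analysis.Analysis" "HOL-Probability.Probability"
begin

abbreviation sph_space :: "'a::euclidean_space measure" where
  "sph_space \<equiv> restrict_space borel (sphere 0 1)"

text \<open>Canonical surface measure on the unit sphere S^(d-1) of a d-dimensional Euclidean
  space, given by the cone construction: sigma(A) = d * Leb {r x. x in A, 0 < r <= 1}.\<close>
definition surf :: "'a::euclidean_space measure" where
  "surf = scale_measure (of_nat DIM('a))
     (distr (restrict_space lborel (cball 0 1 - {0})) sph_space (\<lambda>x. x /\<^sub>R norm x))"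

definition omega :: "'a::euclidean_space itself \<Rightarrow> real" where
  "omega _ = measure (surf :: 'a measure) (sphere 0 1)"

definition subsph :: "'a::euclidean_space \<Rightarrow> 'a set" where
  "subsph x = {v \<in> sphere 0 1. v \<bullet> x = 0}"

text \<open>A linear isometry from R^(d-1) (the type 'b) onto the orthogonal complement of x.\<close>
definition iso :: "'b::euclidean_space itself \<Rightarrow> 'a::euclidean_space \<Rightarrow> 'b \<Rightarrow> 'a" where
  "iso _ x = (SOME f. linear f \<and> (\<forall>y. norm (f y) = norm y) \<and> range f = {y. y \<bullet> x = 0})"

definition mu :: "'b::euclidean_space itself \<Rightarrow> 'a::euclidean_space \<Rightarrow> 'a measure" where
  "mu B x = distr (surf :: 'b measure) (restrict_space borel (subsph x)) (iso B x)"

definition geod :: "'a::euclidean_space \<Rightarrow> 'a \<Rightarrow> real \<Rightarrow> 'a" where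
  "geod x v \<theta> = cos \<theta> *\<^sub>R x + sin \<theta> *\<^sub>R v"

definition lvl :: "('a::euclidean_space \<Rightarrow> real) \<Rightarrow> 'a \<Rightarrow> 'a \<Rightarrow> real \<Rightarrow> real set" where
  "lvl p x v t = {\<theta> \<in> {0..<2*pi}. p (geod x v \<theta>) > t}"

definition Hval :: "'b::euclidean_space itself \<Rightarrow> ('a::euclidean_space \<Rightarrow> real) \<Rightarrow> 'a \<Rightarrow> 'a set \<Rightarrow> ennreal" where
  "Hval B p x A = ennreal (1 / p x) *
     (\<integral>\<^sup>+ t \<in> {0<..<p x}. ennreal (1 / omega B) *
        (\<integral>\<^sup>+ v. (1 / emeasure lborel (lvl p x v t)) *
            (\<integral>\<^sup>+ \<theta> \<in> lvl p x v t. indicator A (geod x v \<theta>) \<partial>lborel) \<partial>(mu B x)) \<partial>lborel)"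

text \<open>The defining formula is well defined at x if the level sets have positive length
  for almost all (t,v).\<close>
definition Hwd :: "'b::euclidean_space itself \<Rightarrow> ('a::euclidean_space \<Rightarrow> real) \<Rightarrow> 'a \<Rightarrow> bool" where
  "Hwd B p x = (AE t in lborel. 0 < t \<and> t < p x \<longrightarrow>
                  (AE v in mu B x. 0 < emeasure lborel (lvl p x v t)))"

definition Hker :: "'b::euclidean_space itself \<Rightarrow> ('a::euclidean_space \<Rightarrow> real) \<Rightarrow> 'a \<Rightarrow> 'a measure" where
  "Hker B p x = (if Hwd B p x then measure_of (sphere 0 1) (sets sph_space) (Hval B p x)
                 else scale_measure (ennreal (1 / omega TYPE('a))) surf)"

fun Hn :: "'b::euclidean_space itself \<Rightarrow> ('a::euclidean_space \<Rightarrow> real) \<Rightarrow> nat \<Rightarrow> 'a \<Rightarrow> 'a measure" where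
  "Hn B p 0 x = return sph_space x"
| "Hn B p (Suc n) x = measure_of (sphere 0 1) (sets sph_space)
      (\<lambda>A. \<integral>\<^sup>+ y. emeasure (Hker B p y) A \<partial>(Hn B p n x))"

definition target :: "('a::euclidean_space \<Rightarrow> real) \<Rightarrow> 'a measure" where
  "target p = density surf (\<lambda>x. ennreal (p x / integral\<^sup>L surf p))"

definition tv :: "'a measure \<Rightarrow> 'a measure \<Rightarrow> real" where
  "tv M N = (SUP A \<in> sets M. \<bar>measure M A - measure N A\<bar>)"

end

theory Submission
  imports Defs
begin

text \<open>Polar coordinates around \<open>x\<close> on the sphere show that, for \<open>\<theta>\<close> uniform on the circle and \<open>v\<close>
  uniform on \<open>S\<^sub>x\<close>, the point \<open>y = cos \<theta> x + sin \<theta> v\<close> carries twice the surface measure once it is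
  weighted by \<open>|sin \<theta>|\<^sup>d\<^sup>-\<^sup>2\<close>. Hence \<open>p(x) H(x, dy)\<close> has a density that depends on \<open>(x, y)\<close> only through
  \<open>min (p x) (p y)\<close>, the angle between \<open>x\<close> and \<open>y\<close>, and the length of the level sets on the great
  circle through \<open>x\<close> and \<open>y\<close>. All three are symmetric, so \<open>H\<close> is reversible and the target is
  stationary. Bounding the length by \<open>2 pi\<close> and the sine by 1 gives the minorization
  \<open>H(x, A) \<ge> \<beta> \<sigma>(A \<inter> C) / (2 pi \<omega>)\<close> uniformly in \<open>x\<close>, and therefore total variation contracts by
  the factor \<open>\<rho>\<close> in every step.\<close>

section \<open>Lebesgue measure under isometries\<close>

text \<open>The measure \<open>mu B x\<close> is an image under an isometry picked by choice, so
  nothing is known about how it varies with \<open>x\<close>. Therefore integrals over directions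
  are turned into integrals against the fixed measure \<open>surf\<close>, with the direction
  recovered from the end point as \<open>gdir x y\<close>. Each great circle through x is traversed
  along v and along -v, so the direction is recovered only up to sign: integrands must be even in v,
  and densities acquire a factor 2. The uniform law that replaces H where its formula fails is a
  second obstacle. The points concerned must form a measurable set for the iterates to make sense
  and a null set for stationarity, yet the minorization has to hold at each of them, because the
  supremum runs over all x. There it follows from \<open>omega TYPE('a) \<le> pi * omega B\<close>,
  the comparison that also keeps \<rho> positive. The bound has no constant in front of \<rho>^n:
  the part common to all laws H(x, .) is removed before integrals are compared, and the initial
  distance is at most 1.\<close>

lemma translation_invariant_measure_proportional:
  fixes M :: "'a::euclidean_space measure"
  assumes "sigma_finite_measure M" and sets[measurable_cong]: "sets M = sets borel"
    and inv: "\<And>a. distr M borel (\<lambda>x. a + x) = M"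
    and [measurable]: "A \<in> sets borel" "B \<in> sets borel"
  shows "emeasure M A * emeasure lborel B = emeasure M (uminus -` B) * emeasure lborel A"
proof -
  interpret M: sigma_finite_measure M by fact
  interpret P: pair_sigma_finite M "lborel :: 'a measure"
    by (simp add: pair_sigma_finite_def assms(1) lborel.sigma_finite_measure_axioms)
  have um[measurable]: "uminus -` B \<in> sets borel"
    using measurable_sets[of "uminus :: 'a \<Rightarrow> 'a" borel borel B] by simp
  have "emeasure M A * emeasure lborel B
      = (\<integral>\<^sup>+x. indicator A x * emeasure lborel B \<partial>M)"
    by (subst nn_integral_multc) (auto simp: sets)
  \<comment> \<open>The integrand couples \<open>A\<close> at x with \<open>B\<close> at y - x.
    Integrating out y first uses invariance of \<open>lborel\<close>; shifting x by y first uses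
    invariance of \<open>M\<close> and leaves -x in \<open>B\<close>, which is the origin of the
    reflection.\<close>
  also have "\<dots> = (\<integral>\<^sup>+x. \<integral>\<^sup>+y. indicator A x * indicator B (y - x) \<partial>lborel \<partial>M)"
  proof (rule nn_integral_cong)
    fix x
    have "(\<integral>\<^sup>+y. indicator B (y - x) \<partial>lborel) = (\<integral>\<^sup>+y. indicator B y \<partial>distr lborel borel (\<lambda>y. - x + y))"
      by (subst nn_integral_distr) auto
    also have "\<dots> = emeasure lborel B"
      using lborel_distr_plus[of "-x"] by (simp del: add_uminus_conv_diff uminus_add_conv_diff)
    finally show "indicator A x * emeasure lborel B = (\<integral>\<^sup>+y. indicator A x * indicator B (y - x) \<partial>lborel)"
      by (subst nn_integral_cmult) auto
  qed
  also have "\<dots> = (\<integral>\<^sup>+y. \<integral>\<^sup>+x. indicator A x * indicator B (y - x) \<partial>M \<partial>lborel)"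
    by (subst P.Fubini') auto
  also have "\<dots> = (\<integral>\<^sup>+y. \<integral>\<^sup>+x. indicator A (y + x) * indicator B (- x) \<partial>M \<partial>lborel)"
  proof (rule nn_integral_cong)
    fix y :: 'a
    have "(\<integral>\<^sup>+x. indicator A x * indicator B (y - x) \<partial>distr M borel (\<lambda>x. y + x)) = (\<integral>\<^sup>+x. indicator A (y + x) * indicator B (- x) \<partial>M)"
      by (subst nn_integral_distr) (auto simp: sets)
    then show "(\<integral>\<^sup>+x. indicator A x * indicator B (y - x) \<partial>M) = (\<integral>\<^sup>+x. indicator A (y + x) * indicator B (- x) \<partial>M)"
      by (simp only: inv)
  qed
  also have "\<dots> = (\<integral>\<^sup>+x. \<integral>\<^sup>+y. indicator A (y + x) * indicator B (- x) \<partial>lborel \<partial>M)"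
    by (subst P.Fubini') auto
  also have "\<dots> = (\<integral>\<^sup>+x. indicator (uminus -` B) x * emeasure lborel A \<partial>M)"
  proof (rule nn_integral_cong)
    fix x
    have "(\<integral>\<^sup>+y. indicator A (y + x) \<partial>lborel) = (\<integral>\<^sup>+y. indicator A y \<partial>distr lborel borel (\<lambda>y. x + y))"
      by (subst nn_integral_distr) (auto simp: add.commute)
    also have "\<dots> = emeasure lborel A"
      using lborel_distr_plus[of "x"] by (simp add: comp_def)
    finally show "(\<integral>\<^sup>+y. indicator A (y + x) * indicator B (- x) \<partial>lborel) = indicator (uminus -` B) x * emeasure lborel A"
      by (subst nn_integral_multc) (auto simp: mult.commute indicator_def)
  qed
  also have "\<dots> = emeasure M (uminus -` B) * emeasure lborel A"
    by (subst nn_integral_multc) (auto simp: sets)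
  finally show ?thesis .
qed

text \<open>Domain and range may be different types, so no determinant is taken. The image measure
  is translation invariant because f is linear and onto, hence proportional to Lebesgue measure, and
  the unit ball, whose preimage is the unit ball of the same dimension, fixes the constant as
  1.\<close>

lemma lborel_distr_linear_isometry:
  fixes f :: "'b::euclidean_space \<Rightarrow> 'a::euclidean_space"
  assumes lin: "linear f" and iso: "\<And>y. norm (f y) = norm y" and surj: "surj f"
  shows "distr lborel borel f = lborel"
proof -
  interpret f: linear f by fact
  have inj: "inj f"
    using iso f.inj_iff_eq_0 by (metis norm_eq_zero)
  have dim: "DIM('b) = DIM('a)"
    using dim_image_eq[OF lin, of UNIV] inj surj by (simp)
  have [measurable]: "f \<in> borel_measurable borel"
    using lin linear_continuous_on linear_conv_bounded_linear borel_measurable_continuous_onI by blast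
  let ?M = "distr lborel borel f"
  have ball: "emeasure ?M (ball 0 r) = emeasure lborel (ball (0::'a) r)" for r :: real
  proof -
    have "f -` ball 0 r = ball 0 r"
      using iso by auto
    then have "emeasure ?M (ball 0 r) = emeasure lborel (ball (0::'b) r)"
      by (simp add: emeasure_distr)
    also have "\<dots> = emeasure lborel (ball (0::'a) r)"
      by (cases "r \<ge> 0") (auto simp: emeasure_ball dim ball_empty)
    finally show ?thesis .
  qed
  have sf: "sigma_finite_measure ?M"
  proof
    show "\<exists>A. countable A \<and> A \<subseteq> sets ?M \<and> \<Union>A = space ?M \<and> (\<forall>a\<in>A. emeasure ?M a \<noteq> \<infinity>)"
    proof (intro exI conjI)
      let ?A = "range (\<lambda>n::nat. ball (0::'a) (real n))"
      show "\<Union>?A = space ?M"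
        by (auto simp: reals_Archimedean2)
      show "\<forall>a\<in>?A. emeasure ?M a \<noteq> \<infinity>"
        using emeasure_lborel_ball_finite[of "0::'a"] by (auto simp: ball less_top)
    qed auto
  qed
  have inv: "distr ?M borel (\<lambda>x. a + x) = ?M" for a
  proof -
    obtain b where b: "a = f b" using surj by auto
    have "distr ?M borel (\<lambda>x. a + x) = distr lborel borel (\<lambda>x. f (b + x))"
      by (subst distr_distr) (auto simp: comp_def b f.add)
    also have "\<dots> = distr (distr lborel borel ((+) b)) borel f"
      by (subst distr_distr) (auto simp: comp_def)
    also have "\<dots> = ?M" by (simp add: lborel_distr_plus)
    finally show ?thesis .
  qed
  let ?B = "ball (0::'a) 1"
  \<comment> \<open>The ball is symmetric, so the reflection in the proportionality lemma
    disappears.\<close>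
  have B: "uminus -` ?B = ?B" by auto
  have fin: "emeasure lborel ?B \<noteq> \<infinity>" "emeasure lborel ?B \<noteq> 0"
    using emeasure_lborel_ball_finite[of "0::'a" 1] by (simp_all add: emeasure_ball less_imp_neq[THEN not_sym, OF unit_ball_vol_pos])
  show ?thesis
  proof (rule measure_eqI)
    fix A assume "A \<in> sets ?M"
    then have A: "A \<in> sets borel" by simp
    have "emeasure ?M A * emeasure lborel ?B = emeasure ?M ?B * emeasure lborel A"
      using translation_invariant_measure_proportional[OF sf _ inv A, of ?B] by (simp only: B) simp
    then have "emeasure ?M A * emeasure lborel ?B / emeasure lborel ?B = emeasure lborel A * emeasure lborel ?B / emeasure lborel ?B"
      by (simp only: ball mult.commute)
    then show "emeasure ?M A = emeasure lborel A"
      using fin by (simp add: mult_divide_eq_ennreal)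
  qed simp
qed

section \<open>Change of variables by the tangent\<close>

lemma tan_less_iff_less_arctan:
  assumes "- (pi/2) < y" "y < pi/2"
  shows "tan y < u \<longleftrightarrow> y < arctan u" "u < tan y \<longleftrightarrow> arctan u < y"
  using assms tan_monotone' arctan[of u] by (metis)+

text \<open>The substitution z = tan \<phi> over the whole line, stated as an equality of measures.
  It then suffices to test bounded intervals, where the fundamental theorem applies on a compact
  interval on which the cosine is positive.\<close>

lemma lborel_eq_distr_tan:
  "lborel = distr (density lborel (\<lambda>y. ennreal (1 / (cos y)\<^sup>2) * indicator {-(pi/2)<..<pi/2} y)) borel tan"
    (is "_ = ?M")
proof (rule lborel_eqI)
  fix l u :: real
  assume "\<And>b. b \<in> Basis \<Longrightarrow> l \<bullet> b \<le> u \<bullet> b"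
  then have lu: "l \<le> u" by simp
  have tm[measurable]: "(tan :: real \<Rightarrow> real) \<in> borel_measurable borel"
    unfolding tan_def by measurable
  have cpos: "cos y > 0" if "y \<in> {arctan l..arctan u}" for y
    using that arctan_lbound[of l] arctan_ubound[of u] by (intro cos_gt_zero_pi) auto
  have "emeasure ?M (box l u) = (\<integral>\<^sup>+y. ennreal (1 / (cos y)\<^sup>2) * indicator {arctan l<..<arctan u} y \<partial>lborel)"
    apply (subst emeasure_distr)
      apply (simp add: tm)
     apply simp
    apply (subst emeasure_density)
      apply simp
     apply (use measurable_sets[OF tm, of "box l u"] in simp)
    apply (intro nn_integral_cong)
    subgoal for y
      using tan_less_iff_less_arctan[of y l] tan_less_iff_less_arctan[of y u]
        arctan_lbound[of l] arctan_ubound[of u]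
      by (auto simp: box_real indicator_def)
    done
  also have "\<dots> = (\<integral>\<^sup>+y. ennreal (1 / (cos y)\<^sup>2) * indicator {arctan l..arctan u} y \<partial>lborel)"
  proof (rule nn_integral_cong_AE)
    have "AE y in lborel. y \<noteq> arctan l" "AE y in lborel. y \<noteq> arctan u"
      by (rule AE_lborel_singleton)+
    then show "AE y in lborel. ennreal (1 / (cos y)\<^sup>2) * indicator {arctan l<..<arctan u} y
       = ennreal (1 / (cos y)\<^sup>2) * indicator {arctan l..arctan u} y"
      by eventually_elim (auto simp: indicator_def)
  qed
  also have "\<dots> = ennreal (tan (arctan u) - tan (arctan l))"
  proof (rule nn_integral_FTC_Icc)
    show "arctan l \<le> arctan u" using lu by (simp add: arctan_le_iff)
    fix y assume y: "y \<in> {arctan l..arctan u}"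
    show "(tan has_real_derivative 1 / (cos y)\<^sup>2) (at y)"
      using cpos[of y] y by (auto intro!: derivative_eq_intros simp: divide_inverse)
  qed auto
  finally show "emeasure ?M (box l u) = (\<Prod>b\<in>Basis. (u - l) \<bullet> b)"
    by (simp add: tan_arctan)
qed simp

section \<open>Polar coordinates\<close>

lemma sets_surf[simp, measurable_cong]: "sets (surf :: 'a::euclidean_space measure) = sets sph_space"
  by (simp add: surf_def)

lemma space_surf[simp]: "space (surf :: 'a::euclidean_space measure) = sphere 0 1"
  using sets_eq_imp_space_eq[OF sets_surf] by (simp add: space_restrict_space)

lemma measurable_surf_of_borel:
  "g \<in> measurable borel N \<Longrightarrow> g \<in> measurable (surf :: 'a::euclidean_space measure) N"
  using measurable_restrict_space1[of g borel N "sphere 0 1"] measurable_cong_sets[OF sets_surf refl] by blast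

lemma nn_integral_surf:
  fixes g :: "'a::euclidean_space \<Rightarrow> ennreal"
  assumes [measurable]: "g \<in> borel_measurable borel"
  shows "(\<integral>\<^sup>+y. g y \<partial>surf)
    = (\<integral>\<^sup>+x. of_nat DIM('a) * g (x /\<^sub>R norm x) * indicator (cball 0 1 - {0}) x \<partial>lborel)"
proof -
  have n: "(\<lambda>x::'a. x /\<^sub>R norm x) \<in> measurable (restrict_space lborel (cball 0 1 - {0})) sph_space"
    by (intro measurable_restrict_space2 measurable_restrict_space1)
       (auto simp: space_restrict_space)
  have W: "(\<lambda>x. g (x /\<^sub>R norm x) * indicator (cball 0 1 - {0::'a}) x) \<in> borel_measurable borel"
    by (intro borel_measurable_times_ennreal borel_measurable_indicator) auto
  have g: "g \<in> borel_measurable sph_space"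
    by (rule measurable_restrict_space1) simp
  have "(\<integral>\<^sup>+y. g y \<partial>surf)
    = of_nat DIM('a) * (\<integral>\<^sup>+x. g (x /\<^sub>R norm x) \<partial>restrict_space lborel (cball 0 1 - {0}))"
    unfolding surf_def
    using n g by (subst nn_integral_scale_measure) (auto simp: nn_integral_distr)
  also have "\<dots> = of_nat DIM('a) * (\<integral>\<^sup>+x. g (x /\<^sub>R norm x) * indicator (cball 0 1 - {0}) x \<partial>lborel)"
    by (subst nn_integral_restrict_space) auto
  also have "\<dots> = (\<integral>\<^sup>+x. of_nat DIM('a) * g (x /\<^sub>R norm x) * indicator (cball 0 1 - {0}) x \<partial>lborel)"
    by (subst nn_integral_cmult[symmetric]) (simp_all add: mult_ac W)
  finally show ?thesis .
qed

lemma emeasure_surf_sphere: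
  "emeasure (surf :: 'a::euclidean_space measure) (sphere 0 1) = ennreal (real DIM('a) * unit_ball_vol DIM('a))"
proof -
  have "emeasure (surf :: 'a measure) (sphere 0 1) = (\<integral>\<^sup>+y. 1 \<partial>(surf :: 'a measure))"
    by simp
  also have "\<dots> = of_nat DIM('a) * emeasure lborel (cball (0::'a) 1 - {0})"
    by (subst nn_integral_surf) (auto simp: nn_integral_cmult_indicator)
  also have "emeasure lborel (cball (0::'a) 1 - {0}) = emeasure lborel (cball (0::'a) 1)"
    by (intro emeasure_eq_AE) (use AE_lborel_singleton[of "0::'a"] in auto)
  finally show ?thesis
    by (simp add: emeasure_cball ennreal_mult ennreal_of_nat_eq_real_of_nat)
qed

lemma finite_measure_surf: "finite_measure (surf :: 'a::euclidean_space measure)"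
  by (rule finite_measureI) (simp add: emeasure_surf_sphere)

interpretation surf: finite_measure "surf :: 'a::euclidean_space measure"
  by (rule finite_measure_surf)

lemma emeasure_surf_sphere_omega:
  fixes T :: "'a::euclidean_space itself"
  shows "emeasure (surf :: 'a measure) (sphere 0 1) = ennreal (omega T)"
  unfolding omega_def by (rule surf.emeasure_eq_measure)

lemma omega_pos:
  fixes T :: "'a::euclidean_space itself"
  shows "0 < omega T"
  unfolding omega_def measure_def emeasure_surf_sphere by simp

section \<open>Polar coordinates in the ambient space\<close>

lemma nn_integral_lborel_scale:
  fixes f :: "'a::euclidean_space \<Rightarrow> ennreal"
  assumes [measurable]: "f \<in> borel_measurable borel" and "c \<noteq> 0"
  shows "(\<integral>\<^sup>+x. f x \<partial>lborel) = (\<integral>\<^sup>+x. ennreal (\<bar>c\<bar> ^ DIM('a)) * f (c *\<^sub>R x) \<partial>lborel)"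
proof -
  have "(\<integral>\<^sup>+x. f x \<partial>lborel) = (\<integral>\<^sup>+x. f x \<partial>density (distr lborel borel (\<lambda>x. c *\<^sub>R x)) (\<lambda>_. ennreal (\<bar>c\<bar> ^ DIM('a))))"
    using lborel_affine[OF \<open>c \<noteq> 0\<close>, of "0::'a"] by simp
  also have "\<dots> = (\<integral>\<^sup>+x. ennreal (\<bar>c\<bar> ^ DIM('a)) * f (c *\<^sub>R x) \<partial>lborel)"
    by (subst nn_integral_density) (simp_all add: nn_integral_distr)
  finally show ?thesis .
qed

lemma nn_integral_power_tail:
  assumes "0 < a" "0 < n"
  shows "(\<integral>\<^sup>+q. ennreal (real n / q ^ (n + 1)) * indicator {a..} q \<partial>lborel) = ennreal (1 / a ^ n)"
proof -
  have "(\<integral>\<^sup>+q. ennreal (real n / q ^ (n + 1)) * indicator {a..} q \<partial>lborel) = ennreal (0 - (- (1 / a ^ n)))"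
  proof (rule nn_integral_FTC_atLeast)
    fix q assume "a \<le> q"
    with assms have q: "q > 0" by simp
    obtain k where n: "n = Suc k" using assms by (cases n) auto
    have "((\<lambda>q. - inverse (q ^ n)) has_real_derivative - (- (inverse (q ^ n) * (real n * q ^ k) * inverse (q ^ n)))) (at q)"
      using q DERIV_pow[of n q] unfolding n by (intro DERIV_minus DERIV_inverse') auto
    also have "- (- (inverse (q ^ n) * (real n * q ^ k) * inverse (q ^ n))) = real n / q ^ (n + 1)"
      using q unfolding n by (simp add: divide_simps)
    finally show "((\<lambda>q. - (1 / q ^ n)) has_real_derivative real n / q ^ (n + 1)) (at q)"
      by (simp add: divide_inverse)
  next
    show "((\<lambda>q::real. - (1 / q ^ n)) \<longlongrightarrow> 0) at_top"
      using tendsto_minus[OF tendsto_divide_0[OF tendsto_const[of "1::real"]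
        filterlim_at_top_imp_at_infinity[OF filterlim_pow_at_top[OF \<open>0 < n\<close> filterlim_ident]]]] by simp
  qed (use assms in auto)
  then show ?thesis by simp
qed

text \<open>With the cone definition of \<open>surf\<close>, the right side is an integral over r
  and over w in the punctured unit ball, evaluating G at r w / |w|. Substituting r = |w| q for fixed
  w and then replacing q w by w for fixed q leaves G w |w|^m times m / q^(m+1) on q \<ge> |w|. By
  \<open>nn_integral_power_tail\<close> the q-integral is |w|^-m, which cancels the weight.\<close>

lemma nn_integral_lborel_polar:
  fixes G :: "'a::euclidean_space \<Rightarrow> ennreal"
  assumes [measurable]: "G \<in> borel_measurable borel"
  shows "(\<integral>\<^sup>+w. G w \<partial>lborel)
    = (\<integral>\<^sup>+r. \<integral>\<^sup>+u. ennreal (r ^ (DIM('a) - 1)) * indicator {0<..} r * G (r *\<^sub>R u) \<partial>surf \<partial>lborel)"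
proof -
  define m where "m = DIM('a)"
  have m: "m > 0" by (simp add: m_def)
  have mm: "x ^ m = x * x ^ (m - 1)" for x :: real
    using m by (simp add: power_eq_if)
  define W where "W = cball (0::'a) 1 - {0}"
  define V where "V = - {0::'a}"
  have [measurable]: "W \<in> sets borel" "V \<in> sets borel" by (auto simp: W_def V_def)
  have "(\<integral>\<^sup>+r. \<integral>\<^sup>+u. ennreal (r ^ (m - 1)) * indicator {0<..} r * G (r *\<^sub>R u) \<partial>surf \<partial>lborel)
     = (\<integral>\<^sup>+r. \<integral>\<^sup>+w. of_nat m * (ennreal (r ^ (m - 1)) * indicator {0<..} r * G (r *\<^sub>R w /\<^sub>R norm w)) * indicator W w \<partial>lborel \<partial>lborel)"
    by (subst nn_integral_surf) (simp_all add: m_def W_def mult_ac)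
  also have "\<dots> = (\<integral>\<^sup>+w. \<integral>\<^sup>+r. of_nat m * (ennreal (r ^ (m - 1)) * indicator {0<..} r * G (r *\<^sub>R w /\<^sub>R norm w)) * indicator W w \<partial>lborel \<partial>lborel)"
    by (subst lborel_pair.Fubini') simp_all
  also have "\<dots> = (\<integral>\<^sup>+w. \<integral>\<^sup>+q. of_nat m * ennreal (q ^ (m - 1)) * indicator {0<..} q * (ennreal (norm w ^ m) * G (q *\<^sub>R w) * indicator W w) \<partial>lborel \<partial>lborel)"
  proof (rule nn_integral_cong)
    fix w :: 'a
    show "(\<integral>\<^sup>+r. of_nat m * (ennreal (r ^ (m - 1)) * indicator {0<..} r * G (r *\<^sub>R w /\<^sub>R norm w)) * indicator W w \<partial>lborel)
        = (\<integral>\<^sup>+q. of_nat m * ennreal (q ^ (m - 1)) * indicator {0<..} q * (ennreal (norm w ^ m) * G (q *\<^sub>R w) * indicator W w) \<partial>lborel)"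
    proof (cases "w = 0")
      case False
      then have w: "norm w > 0" by simp
      show ?thesis
        apply (subst nn_integral_real_affine[where c = "norm w" and t = 0])
        using w apply simp
        using w apply simp
        using w apply (subst nn_integral_cmult[symmetric])
         apply simp
        apply (rule nn_integral_cong)
        subgoal for q
          by (cases "q > 0") (auto simp: mm power_mult_distrib zero_less_mult_iff ennreal_mult mult_ac)
        done
    qed (simp add: W_def)
  qed
  also have "\<dots> = (\<integral>\<^sup>+q. \<integral>\<^sup>+w. of_nat m * ennreal (q ^ (m - 1)) * indicator {0<..} q * (ennreal (norm w ^ m) * G (q *\<^sub>R w) * indicator W w) \<partial>lborel \<partial>lborel)"
    by (subst lborel_pair.Fubini') simp_all
  \<comment> \<open>On \<open>V\<close> the condition \<open>norm w \<le> q\<close> already forces q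
    > 0, so it replaces both the ball indicator and the indicator of positive q.\<close>
  also have "\<dots> = (\<integral>\<^sup>+q. \<integral>\<^sup>+w. G w * indicator V w * ennreal (norm w ^ m) * (ennreal (m / q ^ (m + 1)) * (if norm w \<le> q then 1 else 0)) \<partial>lborel \<partial>lborel)"
  proof (rule nn_integral_cong)
    fix q :: real
    show "(\<integral>\<^sup>+w. of_nat m * ennreal (q ^ (m - 1)) * indicator {0<..} q * (ennreal (norm w ^ m) * G (q *\<^sub>R w) * indicator W w) \<partial>lborel)
       = (\<integral>\<^sup>+w. G w * indicator V w * ennreal (norm w ^ m) * (ennreal (m / q ^ (m + 1)) * (if norm w \<le> q then 1 else 0)) \<partial>lborel)"
    proof (cases "q > 0")
      case False
      then have "\<not> norm w \<le> q" if "w \<noteq> 0" for w :: 'a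
        using that by (meson zero_less_norm_iff not_le order_less_le_trans)
      then show ?thesis using False
        by (intro nn_integral_cong) (auto simp: indicator_def V_def W_def)
    next
      case True
      show ?thesis
        apply (subst (2) nn_integral_lborel_scale[where c = q])
        subgoal by simp
        subgoal using True by simp
        apply (rule nn_integral_cong)
        subgoal for w
        proof (cases "w \<noteq> 0 \<and> norm w \<le> 1")
          case w: True
          have "of_nat m * ennreal (q ^ (m - 1)) * ennreal (norm w ^ m) = ennreal (m * q ^ (m - 1) * norm w ^ m)"
            using True by (simp add: ennreal_mult ennreal_of_nat_eq_real_of_nat)
          also have "m * q ^ (m - 1) * norm w ^ m = q ^ m * ((q * norm w) ^ m * (m / q ^ (m + 1)))"
            using True by (simp add: mm[of q] power_mult_distrib field_simps)
          also have "ennreal \<dots> = ennreal (q ^ m) * ennreal ((q * norm w) ^ m * (m / q ^ (m + 1)))"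
            using True by (intro ennreal_mult) auto
          also have "ennreal ((q * norm w) ^ m * (m / q ^ (m + 1))) = ennreal ((q * norm w) ^ m) * ennreal (m / q ^ (m + 1))"
            using True by (intro ennreal_mult) auto
          finally have eq: "of_nat m * ennreal (q ^ (m - 1)) * ennreal (norm w ^ m) = ennreal (q ^ m) * (ennreal ((q * norm w) ^ m) * ennreal (m / q ^ (m + 1)))" .
          have "of_nat m * ennreal (q ^ (m - 1)) * indicator {0<..} q * (ennreal (norm w ^ m) * G (q *\<^sub>R w) * indicator W w)
            = of_nat m * ennreal (q ^ (m - 1)) * ennreal (norm w ^ m) * G (q *\<^sub>R w)"
            using True w by (simp add: W_def mult_ac)
          then show ?thesis
            unfolding eq using True w by (simp add: m_def[symmetric] V_def mult_ac)
        qed (use True in \<open>auto simp: indicator_def V_def W_def\<close>)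
        done
    qed
  qed
  also have "\<dots> = (\<integral>\<^sup>+w. \<integral>\<^sup>+q. G w * indicator V w * ennreal (norm w ^ m) * (ennreal (m / q ^ (m + 1)) * (if norm w \<le> q then 1 else 0)) \<partial>lborel \<partial>lborel)"
    by (subst lborel_pair.Fubini') simp_all
  also have "\<dots> = (\<integral>\<^sup>+w. G w \<partial>lborel)"
  proof (rule nn_integral_cong_AE)
    have "AE w in lborel. w \<noteq> (0::'a)"
      by (rule AE_lborel_singleton)
    then show "AE w in lborel. (\<integral>\<^sup>+q. G w * indicator V w * ennreal (norm w ^ m) * (ennreal (m / q ^ (m + 1)) * (if norm w \<le> q then 1 else 0)) \<partial>lborel) = G w"
    proof eventually_elim
      fix w :: 'a assume w: "w \<noteq> 0"
      have "(\<integral>\<^sup>+q. G w * indicator V w * ennreal (norm w ^ m) * (ennreal (m / q ^ (m + 1)) * (if norm w \<le> q then 1 else 0)) \<partial>lborel)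
         = G w * indicator V w * ennreal (norm w ^ m) * (\<integral>\<^sup>+q. ennreal (m / q ^ (m + 1)) * (if norm w \<le> q then 1 else 0) \<partial>lborel)"
        by (rule nn_integral_cmult) simp
      also have "(\<integral>\<^sup>+q. ennreal (m / q ^ (m + 1)) * (if norm w \<le> q then 1 else 0) \<partial>lborel)
         = (\<integral>\<^sup>+q. ennreal (m / q ^ (m + 1)) * indicator {norm w..} q \<partial>lborel)"
        by (intro nn_integral_cong) (auto simp: indicator_def)
      also have "G w * indicator V w * ennreal (norm w ^ m) * \<dots> = G w * (ennreal (norm w ^ m) * ennreal (1 / norm w ^ m))"
        using nn_integral_power_tail[of "norm w" m] w m by (simp add: V_def mult.assoc)
      also have "\<dots> = G w"
        using w by (simp add: ennreal_mult[symmetric])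
      finally show "(\<integral>\<^sup>+q. G w * indicator V w * ennreal (norm w ^ m) * (ennreal (m / q ^ (m + 1)) * (if norm w \<le> q then 1 else 0)) \<partial>lborel) = G w" .
    qed
  qed
  finally show ?thesis by (simp add: m_def)
qed

section \<open>Great circles\<close>

text \<open>\<open>surf\<close> lives on the sigma-algebra restricted to the sphere. Integrands are
  kept Borel on the whole space, and this lemma with its companions transfers their measurability to
  \<open>surf\<close>.\<close>

lemma measurable_surf_lborel_of_borel:
  "f \<in> measurable (borel \<Otimes>\<^sub>M borel) N \<Longrightarrow>
   f \<in> measurable ((surf :: 'a::euclidean_space measure) \<Otimes>\<^sub>M (lborel :: 'c::euclidean_space measure)) N"
proof -
  assume f: "f \<in> measurable (borel \<Otimes>\<^sub>M borel) N"
  have "(\<lambda>z. (fst z, snd z)) \<in> measurable ((surf :: 'a measure) \<Otimes>\<^sub>M (lborel :: 'c measure)) (borel \<Otimes>\<^sub>M borel)"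
    by (intro measurable_Pair measurable_compose[OF measurable_fst measurable_surf_of_borel]
        measurable_compose[OF measurable_snd]) auto
  from measurable_compose[OF this f] show ?thesis by simp
qed

lemma measurable_surf_surf_of_borel:
  "f \<in> measurable (borel \<Otimes>\<^sub>M borel) N \<Longrightarrow>
   f \<in> measurable ((surf :: 'a::euclidean_space measure) \<Otimes>\<^sub>M (surf :: 'c::euclidean_space measure)) N"
proof -
  assume f: "f \<in> measurable (borel \<Otimes>\<^sub>M borel) N"
  have "(\<lambda>z. (fst z, snd z)) \<in> measurable ((surf :: 'a measure) \<Otimes>\<^sub>M (surf :: 'c measure)) (borel \<Otimes>\<^sub>M borel)"
    by (intro measurable_Pair measurable_compose[OF measurable_fst measurable_surf_of_borel]
        measurable_compose[OF measurable_snd measurable_surf_of_borel]) auto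
  from measurable_compose[OF this f] show ?thesis by simp
qed

lemma Fubini_surf_lborel:
  fixes H :: "'a::euclidean_space \<Rightarrow> 'c::euclidean_space \<Rightarrow> ennreal"
  assumes "case_prod H \<in> borel_measurable (borel \<Otimes>\<^sub>M borel)"
  shows "(\<integral>\<^sup>+r. \<integral>\<^sup>+u. H u r \<partial>surf \<partial>lborel) = (\<integral>\<^sup>+u. \<integral>\<^sup>+r. H u r \<partial>lborel \<partial>surf)"
proof -
  interpret pair_sigma_finite "surf :: 'a measure" "lborel :: 'c measure"
    by (simp add: pair_sigma_finite_def lborel.sigma_finite_measure_axioms surf.sigma_finite_measure_axioms)
  show ?thesis
    by (rule Fubini'[OF measurable_surf_lborel_of_borel[OF assms]])
qed

lemma Fubini_surf_surf:
  fixes H :: "'a::euclidean_space \<Rightarrow> 'c::euclidean_space \<Rightarrow> ennreal"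
  assumes "case_prod H \<in> borel_measurable (borel \<Otimes>\<^sub>M borel)"
  shows "(\<integral>\<^sup>+y. \<integral>\<^sup>+x. H x y \<partial>surf \<partial>surf) = (\<integral>\<^sup>+x. \<integral>\<^sup>+y. H x y \<partial>surf \<partial>surf)"
proof -
  interpret pair_sigma_finite "surf :: 'a measure" "surf :: 'c measure"
    by (simp add: pair_sigma_finite_def surf.sigma_finite_measure_axioms)
  show ?thesis
    by (rule Fubini'[OF measurable_surf_surf_of_borel[OF assms]])
qed

lemma borel_measurable_nn_integral_surf[measurable (raw)]:
  fixes H :: "'c \<Rightarrow> 'a::euclidean_space \<Rightarrow> ennreal"
  assumes "case_prod H \<in> borel_measurable (M \<Otimes>\<^sub>M borel)"
  shows "(\<lambda>x. \<integral>\<^sup>+y. H x y \<partial>surf) \<in> borel_measurable M"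
proof -
  have "(\<lambda>z. (fst z, snd z)) \<in> measurable (M \<Otimes>\<^sub>M (surf :: 'a measure)) (M \<Otimes>\<^sub>M borel)"
    by (intro measurable_Pair measurable_fst
        measurable_compose[OF measurable_snd measurable_surf_of_borel]) auto
  from measurable_compose[OF this assms] show ?thesis
    by (intro surf.borel_measurable_nn_integral) simp
qed

lemma borel_measurable_linear:
  fixes f :: "'b::euclidean_space \<Rightarrow> 'a::euclidean_space"
  shows "linear f \<Longrightarrow> f \<in> borel_measurable borel"
  using linear_continuous_on linear_conv_bounded_linear borel_measurable_continuous_onI by blast

text \<open>By Pythagoras, (s, w) \<mapsto> s x + f w is a linear isometry of the product space onto
  the ambient space, so isometry invariance and Fubini apply.\<close>

lemma nn_integral_lborel_orthogonal_split:
  fixes x :: "'a::euclidean_space" and f :: "'b::euclidean_space \<Rightarrow> 'a" and g :: "'a \<Rightarrow> ennreal"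
  assumes x: "norm x = 1" and f: "linear f" "\<And>y. norm (f y) = norm y" "range f = {y. y \<bullet> x = 0}"
    and g[measurable]: "g \<in> borel_measurable borel"
  shows "(\<integral>\<^sup>+y. g y \<partial>lborel) = (\<integral>\<^sup>+w. \<integral>\<^sup>+s. g (s *\<^sub>R x + f w) \<partial>lborel \<partial>lborel)"
proof -
  have [measurable]: "f \<in> borel_measurable borel"
    by (rule borel_measurable_linear) fact
  define F :: "real \<times> 'b \<Rightarrow> 'a" where "F = (\<lambda>(s, w). s *\<^sub>R x + f w)"
  have orth: "f w \<bullet> x = 0" "x \<bullet> f w = 0" for w using f(3) by (auto simp: inner_commute[of x])
  have xx: "x \<bullet> x = 1" using x by (simp add: dot_square_norm)
  have lin: "linear F"
    using f(1) by (auto intro!: linearI simp: F_def linear_add linear_scale algebra_simps)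
  have nrm: "norm (F z) = norm z" for z
  proof -
    obtain s w where z: "z = (s, w)" by (cases z)
    have "(norm (F z))\<^sup>2 = s\<^sup>2 + (norm (f w))\<^sup>2"
      unfolding F_def z power2_norm_eq_inner by (simp add: inner_simps orth xx power2_eq_square)
    moreover have "norm (f w) = norm w" by (rule f(2))
    moreover have "(norm z)\<^sup>2 = s\<^sup>2 + (norm w)\<^sup>2"
      by (simp add: z norm_Pair)
    ultimately have "(norm (F z))\<^sup>2 = (norm z)\<^sup>2" by (simp only:)
    then show ?thesis by (rule power2_eq_imp_eq) simp_all
  qed
  have surj: "surj F"
    unfolding surj_def
  proof
    fix y
    have "y - (y \<bullet> x) *\<^sub>R x \<in> range f" by (simp add: f(3) inner_simps xx)
    then obtain w where "y - (y \<bullet> x) *\<^sub>R x = f w" by auto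
    then have "F (y \<bullet> x, w) = y" by (simp add: F_def algebra_simps)
    then show "\<exists>z. y = F z" by metis
  qed
  have [measurable]: "F \<in> borel_measurable borel"
    by (rule borel_measurable_linear) fact
  have "(\<integral>\<^sup>+y. g y \<partial>lborel) = (\<integral>\<^sup>+y. g y \<partial>distr lborel borel F)"
    by (simp add: lborel_distr_linear_isometry[OF lin nrm surj])
  also have "\<dots> = (\<integral>\<^sup>+z. g (F z) \<partial>(lborel \<Otimes>\<^sub>M lborel))"
    by (subst nn_integral_distr) (simp_all add: lborel_prod)
  also have "\<dots> = (\<integral>\<^sup>+w. \<integral>\<^sup>+s. g (F (s, w)) \<partial>lborel \<partial>lborel)"
    by (subst lborel_pair.nn_integral_snd[symmetric]) (simp_all add: lborel_prod)
  finally show ?thesis by (simp add: F_def)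
qed

lemma nn_integral_lborel_tan:
  fixes k :: "real \<Rightarrow> ennreal"
  assumes [measurable]: "k \<in> borel_measurable borel"
  shows "(\<integral>\<^sup>+z. k z \<partial>lborel)
    = (\<integral>\<^sup>+\<phi>. ennreal (1 / (cos \<phi>)\<^sup>2) * indicator {-(pi/2)<..<pi/2} \<phi> * k (tan \<phi>) \<partial>lborel)"
proof -
  have [measurable]: "(tan :: real \<Rightarrow> real) \<in> borel_measurable borel"
    unfolding tan_def by measurable
  have "(\<integral>\<^sup>+z. k z \<partial>lborel)
    = (\<integral>\<^sup>+z. k z \<partial>distr (density lborel (\<lambda>y. ennreal (1 / (cos y)\<^sup>2) * indicator {-(pi/2)<..<pi/2} y)) borel tan)"
    using lborel_eq_distr_tan by simp
  also have "\<dots> = (\<integral>\<^sup>+\<phi>. ennreal (1 / (cos \<phi>)\<^sup>2) * indicator {-(pi/2)<..<pi/2} \<phi> * k (tan \<phi>) \<partial>lborel)"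
    by (subst nn_integral_distr, simp, simp, subst nn_integral_density) simp_all
  finally show ?thesis .
qed

text \<open>The cone over the sphere is integrated in coordinates \<open>y = s x + r f(u)\<close>, \<open>s = r tan \<phi>\<close>, in
  which \<open>y / |y| = sin \<phi> x + cos \<phi> f(u)\<close> and \<open>|y| = r / cos \<phi>\<close>.\<close>

lemma nn_integral_surf_latitude:
  fixes x :: "'a::euclidean_space" and f :: "'b::euclidean_space \<Rightarrow> 'a" and g :: "'a \<Rightarrow> ennreal"
  assumes x: "norm x = 1" and f: "linear f" "\<And>y. norm (f y) = norm y" "range f = {y. y \<bullet> x = 0}"
    and dim: "DIM('b) + 1 = DIM('a)"
    and g[measurable]: "g \<in> borel_measurable borel"
  shows "(\<integral>\<^sup>+y. g y \<partial>surf) = (\<integral>\<^sup>+u. \<integral>\<^sup>+\<phi>. ennreal (cos \<phi> ^ (DIM('b) - 1)) *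
     indicator {-(pi/2)<..<pi/2} \<phi> * g (sin \<phi> *\<^sub>R x + cos \<phi> *\<^sub>R f u) \<partial>lborel \<partial>surf)"
proof -
  define m where "m = DIM('b)"
  have m: "m > 0" by (simp add: m_def)
  have dim': "DIM('a) = m + 1" using dim by (simp add: m_def)
  have [measurable]: "f \<in> borel_measurable borel"
    by (rule borel_measurable_linear) fact
  define I where "I = {-(pi/2)<..<pi/2}"
  have [measurable]: "I \<in> sets borel" by (simp add: I_def)
  define W where "W = cball (0::'a) 1 - {0}"
  have [measurable]: "W \<in> sets borel" by (auto simp: W_def)
  have orth: "f w \<bullet> x = 0" "x \<bullet> f w = 0" for w using f(3) by (auto simp: inner_commute[of x])
  have xx: "x \<bullet> x = 1" using x by (simp add: dot_square_norm)
  define K where "K = (\<lambda>y. of_nat (m + 1) * g (y /\<^sub>R norm y) * indicator W y)"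
  have [measurable]: "K \<in> borel_measurable borel" unfolding K_def by measurable
  define J where "J = (\<lambda>\<phi> u. of_nat (m + 1) * (ennreal (1 / (cos \<phi>)\<^sup>2) * indicator I \<phi> * g (sin \<phi> *\<^sub>R x + cos \<phi> *\<^sub>R f u)))"
  have [measurable]: "(\<lambda>(\<phi>, u). J \<phi> u) \<in> borel_measurable (borel \<Otimes>\<^sub>M borel)"
    unfolding J_def by measurable
  \<comment> \<open>The power \<open>r ^ m\<close> is \<open>r ^ (m - 1)\<close> from polar
    coordinates in the hyperplane times the r in ds = r d(tan \<phi>). The cone condition r / cos
    \<phi> \<le> 1 becomes \<open>r \<le> cos \<phi>\<close>.\<close>
  define E where "E = (\<lambda>r \<phi>. ennreal (r ^ m) * (if 0 < r \<and> r \<le> cos \<phi> then 1 else 0))"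
  have [measurable]: "(\<lambda>(r, \<phi>). E r \<phi>) \<in> borel_measurable (borel \<Otimes>\<^sub>M borel)"
    unfolding E_def by measurable
  have inner: "ennreal (r ^ (m - 1)) * indicator {0<..} r * (\<integral>\<^sup>+s. K (s *\<^sub>R x + f (r *\<^sub>R u)) \<partial>lborel)
      = (\<integral>\<^sup>+\<phi>. E r \<phi> * J \<phi> u \<partial>lborel)" (is "?L = ?R") if u: "u \<in> sphere 0 1" for r u
  proof (cases "r > 0")
    case False
    then show ?thesis by (simp add: E_def)
  next
    case True
    have rm: "ennreal (r ^ m) = ennreal (r ^ (m - Suc 0)) * ennreal r"
      using m True by (cases m) (simp_all add: mult.commute ennreal_mult)
    have "(\<integral>\<^sup>+s. K (s *\<^sub>R x + f (r *\<^sub>R u)) \<partial>lborel) = ennreal r * (\<integral>\<^sup>+z. K ((r * z) *\<^sub>R x + f (r *\<^sub>R u)) \<partial>lborel)"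
      using True by (subst nn_integral_real_affine[where c = r and t = 0]) simp_all
    also have "\<dots> = ennreal r * (\<integral>\<^sup>+\<phi>. ennreal (1 / (cos \<phi>)\<^sup>2) * indicator I \<phi> * K ((r * tan \<phi>) *\<^sub>R x + f (r *\<^sub>R u)) \<partial>lborel)"
      unfolding I_def by (subst nn_integral_lborel_tan) simp_all
    finally have "?L = ennreal (r ^ m) * (\<integral>\<^sup>+\<phi>. ennreal (1 / (cos \<phi>)\<^sup>2) * indicator I \<phi> * K ((r * tan \<phi>) *\<^sub>R x + f (r *\<^sub>R u)) \<partial>lborel)"
      using True rm by (simp add: mult.assoc)
    also have "\<dots> = (\<integral>\<^sup>+\<phi>. ennreal (r ^ m) * (ennreal (1 / (cos \<phi>)\<^sup>2) * indicator I \<phi> * K ((r * tan \<phi>) *\<^sub>R x + f (r *\<^sub>R u))) \<partial>lborel)"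
      unfolding tan_def by (subst nn_integral_cmult) simp_all
    also have "\<dots> = ?R"
    proof (rule nn_integral_cong)
      fix \<phi>
      show "ennreal (r ^ m) * (ennreal (1 / (cos \<phi>)\<^sup>2) * indicator I \<phi> * K ((r * tan \<phi>) *\<^sub>R x + f (r *\<^sub>R u))) = E r \<phi> * J \<phi> u"
      proof (cases "\<phi> \<in> I")
        case \<phi>: True
        then have c: "cos \<phi> > 0" unfolding I_def by (intro cos_gt_zero_pi) auto
        define y where "y = sin \<phi> *\<^sub>R x + cos \<phi> *\<^sub>R f u"
        have "(norm y)\<^sup>2 = (sin \<phi>)\<^sup>2 + (cos \<phi>)\<^sup>2 * (norm (f u))\<^sup>2"
          unfolding y_def power2_norm_eq_inner by (simp add: inner_simps orth xx power2_eq_square)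
        then have ny: "norm y = 1" using u f(2) by (simp add: abs_square_eq_1)
        have eq: "(r * tan \<phi>) *\<^sub>R x + f (r *\<^sub>R u) = (r / cos \<phi>) *\<^sub>R y"
          using c f(1) by (simp add: y_def linear_scale scaleR_add_right tan_def)
        have "y \<noteq> 0" using ny by auto
        then have "K ((r / cos \<phi>) *\<^sub>R y) = of_nat (m + 1) * g y * (if r \<le> cos \<phi> then 1 else 0)"
          using True c ny by (auto simp: K_def W_def indicator_def)
        then show ?thesis
          using True by (simp add: eq E_def J_def y_def[symmetric] mult_ac)
      qed (simp add: J_def)
    qed
    finally show ?thesis .
  qed
  have "(\<integral>\<^sup>+y. g y \<partial>surf) = (\<integral>\<^sup>+y. K y \<partial>lborel)"
    by (subst nn_integral_surf) (simp_all add: K_def W_def dim')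
  also have "\<dots> = (\<integral>\<^sup>+w. \<integral>\<^sup>+s. K (s *\<^sub>R x + f w) \<partial>lborel \<partial>lborel)"
    by (rule nn_integral_lborel_orthogonal_split[OF x f]) simp_all
  also have "\<dots> = (\<integral>\<^sup>+r. \<integral>\<^sup>+u. ennreal (r ^ (m - 1)) * indicator {0<..} r * (\<integral>\<^sup>+s. K (s *\<^sub>R x + f (r *\<^sub>R u)) \<partial>lborel) \<partial>surf \<partial>lborel)"
    unfolding m_def by (rule nn_integral_lborel_polar) simp
  also have "\<dots> = (\<integral>\<^sup>+r. \<integral>\<^sup>+u. \<integral>\<^sup>+\<phi>. E r \<phi> * J \<phi> u \<partial>lborel \<partial>surf \<partial>lborel)"
    by (rule nn_integral_cong, rule nn_integral_cong) (rule inner, simp)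
  also have "\<dots> = (\<integral>\<^sup>+u. \<integral>\<^sup>+r. \<integral>\<^sup>+\<phi>. E r \<phi> * J \<phi> u \<partial>lborel \<partial>lborel \<partial>surf)"
    by (rule Fubini_surf_lborel) simp
  also have "\<dots> = (\<integral>\<^sup>+u. \<integral>\<^sup>+\<phi>. \<integral>\<^sup>+r. E r \<phi> * J \<phi> u \<partial>lborel \<partial>lborel \<partial>surf)"
    by (rule nn_integral_cong) (subst lborel_pair.Fubini', simp_all)
  \<comment> \<open>The r-integral is cos \<phi> ^ (m + 1) / (m + 1): its denominator cancels the
    cone factor \<open>m + 1\<close>, and the 1 / cos^2 from the tangent substitution lowers the
    exponent to \<open>m - 1\<close>.\<close>
  also have "\<dots> = (\<integral>\<^sup>+u. \<integral>\<^sup>+\<phi>. ennreal (cos \<phi> ^ (m - 1)) * indicator I \<phi> * g (sin \<phi> *\<^sub>R x + cos \<phi> *\<^sub>R f u) \<partial>lborel \<partial>surf)"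
  proof (rule nn_integral_cong, rule nn_integral_cong)
    fix u \<phi>
    show "(\<integral>\<^sup>+r. E r \<phi> * J \<phi> u \<partial>lborel) = ennreal (cos \<phi> ^ (m - 1)) * indicator I \<phi> * g (sin \<phi> *\<^sub>R x + cos \<phi> *\<^sub>R f u)"
    proof (cases "\<phi> \<in> I")
      case True
      then have c: "cos \<phi> > 0" unfolding I_def by (intro cos_gt_zero_pi) auto
      have "(\<integral>\<^sup>+r. E r \<phi> * J \<phi> u \<partial>lborel) = (\<integral>\<^sup>+r. E r \<phi> \<partial>lborel) * J \<phi> u"
        by (rule nn_integral_multc) simp
      also have "(\<integral>\<^sup>+r. E r \<phi> \<partial>lborel) = (\<integral>\<^sup>+r. ennreal (r ^ m) * indicator {0..cos \<phi>} r \<partial>lborel)"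
        using m by (intro nn_integral_cong) (auto simp: E_def indicator_def)
      also have "\<dots> = ennreal (cos \<phi> ^ (m + 1) / (m + 1) - 0 ^ (m + 1) / (m + 1))"
      proof (rule nn_integral_FTC_Icc)
        fix r :: real
        have "((\<lambda>r. r ^ (m + 1) / real (m + 1)) has_real_derivative real (m + 1) * r ^ (m + 1 - Suc 0) / real (m + 1)) (at r)"
          by (intro DERIV_cdivide DERIV_pow)
        then show "((\<lambda>r. r ^ (m + 1) / real (m + 1)) has_real_derivative r ^ m) (at r)"
          by simp
      qed (use c in auto)
      also have "\<dots> = ennreal (cos \<phi> ^ (m + 1) / (m + 1))" by simp
      also have "\<dots> * J \<phi> u = (ennreal (cos \<phi> ^ (m + 1) / (m + 1)) * ennreal (m + 1) * ennreal (1 / (cos \<phi>)\<^sup>2)) * g (sin \<phi> *\<^sub>R x + cos \<phi> *\<^sub>R f u)"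
        using True unfolding J_def by (simp add: mult_ac ennreal_of_nat_eq_real_of_nat)
      also have "ennreal (cos \<phi> ^ (m + 1) / (m + 1)) * ennreal (m + 1) * ennreal (1 / (cos \<phi>)\<^sup>2) = ennreal (cos \<phi> ^ (m + 1) / (m + 1) * (m + 1) * (1 / (cos \<phi>)\<^sup>2))"
        using c ennreal_mult[of "cos \<phi> ^ (m + 1) / (m + 1)" "m + 1"]
          ennreal_mult[of "cos \<phi> ^ (m + 1) / (m + 1) * (m + 1)" "1 / (cos \<phi>)\<^sup>2"] by simp
      also have "cos \<phi> ^ (m + 1) / (m + 1) * (m + 1) * (1 / (cos \<phi>)\<^sup>2) = cos \<phi> ^ (m - 1)"
      proof -
        have "cos \<phi> ^ (m + 1) = cos \<phi> ^ (m - 1) * (cos \<phi>)\<^sup>2"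
          using m by (cases m) (simp_all add: power2_eq_square)
        then show ?thesis using c by (simp del: power_Suc)
      qed
      finally show ?thesis using True by simp
    qed (simp add: J_def)
  qed
  finally show ?thesis by (simp add: m_def I_def)
qed

text \<open>Two copies of the latitude formula are added. With f and \<phi> = pi/2 - \<theta> it
  covers 0 < \<theta> < pi; with the isometry -f and \<phi> = \<theta> - 3 pi/2 it covers pi <
  \<theta> < 2 pi. Each copy is the whole sphere, hence the factor 2.\<close>

lemma nn_integral_surf_great_circle:
  fixes x :: "'a::euclidean_space" and f :: "'b::euclidean_space \<Rightarrow> 'a" and g :: "'a \<Rightarrow> ennreal"
  assumes x: "norm x = 1" and f: "linear f" "\<And>y. norm (f y) = norm y" "range f = {y. y \<bullet> x = 0}"
    and dim: "DIM('b) + 1 = DIM('a)" "2 \<le> DIM('b)"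
    and g[measurable]: "g \<in> borel_measurable borel"
  shows "2 * (\<integral>\<^sup>+y. g y \<partial>surf) = (\<integral>\<^sup>+u. \<integral>\<^sup>+\<theta>. ennreal (\<bar>sin \<theta>\<bar> ^ (DIM('b) - 1)) *
     indicator {0..<2*pi} \<theta> * g (cos \<theta> *\<^sub>R x + sin \<theta> *\<^sub>R f u) \<partial>lborel \<partial>surf)"
proof -
  have [measurable]: "f \<in> borel_measurable borel"
    by (rule borel_measurable_linear) fact
  define n where "n = DIM('b) - 1"
  have n: "n > 0" using dim by (simp add: n_def)
  let ?h = "\<lambda>\<theta> u. g (cos \<theta> *\<^sub>R x + sin \<theta> *\<^sub>R f u)"
  let ?P = "\<lambda>\<theta> u. ennreal (\<bar>sin \<theta>\<bar> ^ n) * indicator {0<..<pi} \<theta> * ?h \<theta> u"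
  let ?N = "\<lambda>\<theta> u. ennreal (\<bar>sin \<theta>\<bar> ^ n) * indicator {pi<..<2*pi} \<theta> * ?h \<theta> u"
  have "(\<integral>\<^sup>+y. g y \<partial>surf) = (\<integral>\<^sup>+u. \<integral>\<^sup>+\<phi>. ennreal (cos \<phi> ^ n) *
     indicator {-(pi/2)<..<pi/2} \<phi> * g (sin \<phi> *\<^sub>R x + cos \<phi> *\<^sub>R f u) \<partial>lborel \<partial>surf)"
    unfolding n_def by (rule nn_integral_surf_latitude) (use assms in auto)
  also have "\<dots> = (\<integral>\<^sup>+u. \<integral>\<^sup>+\<theta>. ?P \<theta> u \<partial>lborel \<partial>surf)"
    apply (rule nn_integral_cong)
    apply (subst nn_integral_real_affine[where c = "-1" and t = "pi/2"])
      apply simp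
     apply simp
    apply (simp add: sin_diff cos_diff)
    apply (rule nn_integral_cong)
    subgoal for u \<theta>
      using sin_gt_zero[of \<theta>] by (cases "0 < \<theta> \<and> \<theta> < pi") (auto simp: indicator_def)
    done
  finally have P: "(\<integral>\<^sup>+y. g y \<partial>surf) = (\<integral>\<^sup>+u. \<integral>\<^sup>+\<theta>. ?P \<theta> u \<partial>lborel \<partial>surf)" .
  have "(\<integral>\<^sup>+y. g y \<partial>surf) = (\<integral>\<^sup>+u. \<integral>\<^sup>+\<phi>. ennreal (cos \<phi> ^ n) *
     indicator {-(pi/2)<..<pi/2} \<phi> * g (sin \<phi> *\<^sub>R x + cos \<phi> *\<^sub>R (- f u)) \<partial>lborel \<partial>surf)"
    unfolding n_def
  proof (rule nn_integral_surf_latitude)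
    show "range (\<lambda>u. - f u) = {y. y \<bullet> x = 0}"
    proof (intro equalityI subsetI)
      fix y assume "y \<in> {y. y \<bullet> x = 0}"
      then have "- y \<in> range f" using f(3) by simp
      then obtain u where "- y = f u" by auto
      then have "y = - f u" by (metis minus_minus)
      then show "y \<in> range (\<lambda>u. - f u)" by blast
    qed (use f(3) in \<open>auto simp: inner_minus_left\<close>)
  qed (use assms in \<open>auto intro: linear_compose_neg\<close>)
  also have "\<dots> = (\<integral>\<^sup>+u. \<integral>\<^sup>+\<theta>. ?N \<theta> u \<partial>lborel \<partial>surf)"
  proof (rule nn_integral_cong)
    fix u
    have c: "cos (3 * pi / 2) = 0" "sin (3 * pi / 2) = -1"
      using cos_add[of pi "pi/2"] sin_add[of pi "pi/2"] by (simp_all add: algebra_simps)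
    have neg: "sin \<theta> < 0" if "pi < \<theta>" "\<theta> < 2 * pi" for \<theta>
      using sin_gt_zero[of "\<theta> - pi"] that by (simp add: sin_diff)
    have c': "cos (\<theta> - 3 * pi / 2) = - sin \<theta>" "sin (\<theta> - 3 * pi / 2) = cos \<theta>" for \<theta>
      using c by (simp_all add: sin_diff cos_diff)
    have "(\<integral>\<^sup>+\<phi>. ennreal (cos \<phi> ^ n) * indicator {-(pi/2)<..<pi/2} \<phi> * g (sin \<phi> *\<^sub>R x + cos \<phi> *\<^sub>R (- f u)) \<partial>lborel)
       = (\<integral>\<^sup>+\<theta>. ennreal (cos (\<theta> - 3 * pi / 2) ^ n) * indicator {-(pi/2)<..<pi/2} (\<theta> - 3 * pi / 2) * g (sin (\<theta> - 3 * pi / 2) *\<^sub>R x + cos (\<theta> - 3 * pi / 2) *\<^sub>R (- f u)) \<partial>lborel)"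
      by (subst nn_integral_real_affine[where c = 1 and t = "- 3 * pi / 2"]) (simp_all add: add.commute)
    also have "\<dots> = (\<integral>\<^sup>+\<theta>. ?N \<theta> u \<partial>lborel)"
      unfolding c'
      apply (rule nn_integral_cong)
      subgoal for \<theta>
        using neg[of \<theta>] by (cases "pi < \<theta> \<and> \<theta> < 2 * pi") (auto simp: indicator_def)
      done
    finally show "(\<integral>\<^sup>+\<phi>. ennreal (cos \<phi> ^ n) * indicator {-(pi/2)<..<pi/2} \<phi> * g (sin \<phi> *\<^sub>R x + cos \<phi> *\<^sub>R (- f u)) \<partial>lborel)
       = (\<integral>\<^sup>+\<theta>. ?N \<theta> u \<partial>lborel)" .
  qed
  finally have N: "(\<integral>\<^sup>+y. g y \<partial>surf) = (\<integral>\<^sup>+u. \<integral>\<^sup>+\<theta>. ?N \<theta> u \<partial>lborel \<partial>surf)" .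
  have "2 * (\<integral>\<^sup>+y. g y \<partial>surf) = (\<integral>\<^sup>+u. \<integral>\<^sup>+\<theta>. ?P \<theta> u \<partial>lborel \<partial>surf) + (\<integral>\<^sup>+u. \<integral>\<^sup>+\<theta>. ?N \<theta> u \<partial>lborel \<partial>surf)"
    by (simp only: P[symmetric] N[symmetric] mult_2[of "\<integral>\<^sup>+y. g y \<partial>surf"])
  also have "\<dots> = (\<integral>\<^sup>+u. (\<integral>\<^sup>+\<theta>. ?P \<theta> u \<partial>lborel) + (\<integral>\<^sup>+\<theta>. ?N \<theta> u \<partial>lborel) \<partial>surf)"
    by (rule nn_integral_add[symmetric]; rule measurable_surf_of_borel; measurable)
  also have "\<dots> = (\<integral>\<^sup>+u. \<integral>\<^sup>+\<theta>. ?P \<theta> u + ?N \<theta> u \<partial>lborel \<partial>surf)"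
    by (intro nn_integral_cong nn_integral_add[symmetric]) measurable
  \<comment> \<open>The exponent \<open>n\<close> is positive, so the weight vanishes at \<theta> =
    0 and \<theta> = pi, and the two open half circles add up pointwise.\<close>
  also have "\<dots> = (\<integral>\<^sup>+u. \<integral>\<^sup>+\<theta>. ennreal (\<bar>sin \<theta>\<bar> ^ n) * indicator {0..<2*pi} \<theta> * ?h \<theta> u \<partial>lborel \<partial>surf)"
  proof (rule nn_integral_cong, rule nn_integral_cong)
    fix u \<theta>
    have "\<theta> = 0 \<or> \<theta> = pi \<or> \<theta> \<in> {0<..<pi} \<or> \<theta> \<in> {pi<..<2*pi} \<or> \<theta> \<notin> {0..<2*pi}" by force
    then show "?P \<theta> u + ?N \<theta> u = ennreal (\<bar>sin \<theta>\<bar> ^ n) * indicator {0..<2*pi} \<theta> * ?h \<theta> u"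
      using n by (elim disjE) (auto simp: indicator_def)
  qed
  finally show ?thesis by (simp add: n_def)
qed

section \<open>The symmetric kernel\<close>

text \<open>The angles \<alpha> - \<theta> fill the period (\<alpha> - c, \<alpha>]; its negative
  part is moved up by c. This serves to compare a great circle parametrized from two of its
  points.\<close>

lemma nn_integral_periodic_reflect:
  fixes k :: "real \<Rightarrow> ennreal"
  assumes [measurable]: "k \<in> borel_measurable borel"
    and per: "\<And>\<theta>. k (\<theta> + c) = k \<theta>" and \<alpha>: "0 \<le> \<alpha>" "\<alpha> < c"
  shows "(\<integral>\<^sup>+\<theta>. indicator {0..<c} \<theta> * k (\<alpha> - \<theta>) \<partial>lborel) = (\<integral>\<^sup>+\<theta>. indicator {0..<c} \<theta> * k \<theta> \<partial>lborel)"
proof -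
  have "(\<integral>\<^sup>+\<theta>. indicator {0..<c} \<theta> * k (\<alpha> - \<theta>) \<partial>lborel) = (\<integral>\<^sup>+\<theta>. indicator {0..<c} (\<alpha> - \<theta>) * k \<theta> \<partial>lborel)"
    by (subst nn_integral_real_affine[where c = "-1" and t = \<alpha>]) simp_all
  also have "\<dots> = (\<integral>\<^sup>+\<theta>. indicator {0..\<alpha>} \<theta> * k \<theta> + indicator {\<alpha>-c<..<0} \<theta> * k \<theta> \<partial>lborel)"
    using \<alpha> by (intro nn_integral_cong) (auto simp: indicator_def)
  also have "\<dots> = (\<integral>\<^sup>+\<theta>. indicator {0..\<alpha>} \<theta> * k \<theta> \<partial>lborel) + (\<integral>\<^sup>+\<theta>. indicator {\<alpha>-c<..<0} \<theta> * k \<theta> \<partial>lborel)"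
    by (rule nn_integral_add) simp_all
  also have "(\<integral>\<^sup>+\<theta>. indicator {\<alpha>-c<..<0} \<theta> * k \<theta> \<partial>lborel) = (\<integral>\<^sup>+\<theta>. indicator {\<alpha>-c<..<0} (\<theta> - c) * k (\<theta> - c) \<partial>lborel)"
    by (subst nn_integral_real_affine[where c = 1 and t = "-c"]) simp_all
  also have "\<dots> = (\<integral>\<^sup>+\<theta>. indicator {\<alpha><..<c} \<theta> * k \<theta> \<partial>lborel)"
  proof (rule nn_integral_cong)
    fix \<theta>
    show "indicator {\<alpha>-c<..<0} (\<theta> - c) * k (\<theta> - c) = indicator {\<alpha><..<c} \<theta> * k \<theta>"
      using per[of "\<theta> - c"] by (auto simp: indicator_def)
  qed
  also have "(\<integral>\<^sup>+\<theta>. indicator {0..\<alpha>} \<theta> * k \<theta> \<partial>lborel) + (\<integral>\<^sup>+\<theta>. indicator {\<alpha><..<c} \<theta> * k \<theta> \<partial>lborel)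
     = (\<integral>\<^sup>+\<theta>. indicator {0..\<alpha>} \<theta> * k \<theta> + indicator {\<alpha><..<c} \<theta> * k \<theta> \<partial>lborel)"
    by (rule nn_integral_add[symmetric]) simp_all
  also have "\<dots> = (\<integral>\<^sup>+\<theta>. indicator {0..<c} \<theta> * k \<theta> \<partial>lborel)"
    using \<alpha> by (intro nn_integral_cong) (auto simp: indicator_def)
  finally show ?thesis .
qed

section \<open>Angles and directions between points of the sphere\<close>

definition gsin :: "'a::euclidean_space \<Rightarrow> 'a \<Rightarrow> real" where
  "gsin x y = sqrt (1 - (x \<bullet> y)\<^sup>2)"

text \<open>The unit tangent at x towards y, for unit vectors with y different from x and -x. In
  those two cases the convention for division by zero gives 0.\<close>

definition gdir :: "'a::euclidean_space \<Rightarrow> 'a \<Rightarrow> 'a" where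
  "gdir x y = (y - (x \<bullet> y) *\<^sub>R x) /\<^sub>R gsin x y"

lemma gsin_measurable[measurable (raw)]:
  assumes [measurable]: "f \<in> borel_measurable M" "g \<in> borel_measurable M"
  shows "(\<lambda>\<omega>. gsin (f \<omega>) (g \<omega>)) \<in> borel_measurable M"
  unfolding gsin_def by measurable

lemma gdir_measurable[measurable (raw)]:
  assumes [measurable]: "f \<in> borel_measurable M" "g \<in> borel_measurable M"
  shows "(\<lambda>\<omega>. gdir (f \<omega>) (g \<omega>)) \<in> borel_measurable M"
  unfolding gdir_def by measurable

lemma geod_measurable[measurable (raw)]:
  assumes [measurable]: "f \<in> borel_measurable M" "g \<in> borel_measurable M" "h \<in> borel_measurable M"
  shows "(\<lambda>\<omega>. geod (f \<omega>) (g \<omega>) (h \<omega>)) \<in> borel_measurable M"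
  unfolding geod_def by measurable

lemma gsin_commute: "gsin x y = gsin y x"
  by (simp add: gsin_def inner_commute)

lemma gsin_bounds:
  assumes "norm x = 1" "norm y = 1"
  shows "0 \<le> gsin x y" "gsin x y \<le> 1"
proof -
  have "\<bar>x \<bullet> y\<bar> \<le> 1" using Cauchy_Schwarz_ineq2[of x y] assms by simp
  then have "(x \<bullet> y)\<^sup>2 \<le> 1" by (simp add: abs_square_le_1)
  then show "0 \<le> gsin x y" "gsin x y \<le> 1" by (simp_all add: gsin_def)
qed

lemma inner_geod:
  assumes "norm x = 1" "v \<bullet> x = 0"
  shows "x \<bullet> geod x v \<theta> = cos \<theta>"
  using assms by (simp add: geod_def inner_simps inner_commute[of x v] dot_square_norm)

lemma gsin_geod:
  assumes "norm x = 1" "v \<bullet> x = 0"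
  shows "gsin x (geod x v \<theta>) = \<bar>sin \<theta>\<bar>"
  by (simp add: gsin_def inner_geod[OF assms] sin_squared_eq[symmetric])

lemma gdir_geod:
  assumes "norm x = 1" "v \<bullet> x = 0" "sin \<theta> \<noteq> 0"
  shows "gdir x (geod x v \<theta>) = sgn (sin \<theta>) *\<^sub>R v"
proof -
  have "geod x v \<theta> - cos \<theta> *\<^sub>R x = sin \<theta> *\<^sub>R v" by (simp add: geod_def)
  then show ?thesis
    by (simp add: gdir_def inner_geod[OF assms(1,2)] gsin_geod[OF assms(1,2)] sgn_real_def)
qed

lemma geod_minus: "geod x (- v) \<theta> = geod x v (- \<theta>)"
  by (simp add: geod_def)

text \<open>Both curves run along the great circle through x and y, in opposite senses: the
  direction at y towards x is sin \<alpha> x - cos \<alpha> v, where v is the direction at x towards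
  y and \<alpha> is the angle between the points.\<close>

lemma geod_gdir_commute:
  assumes "norm x = 1" "norm y = 1" "gsin x y \<noteq> 0"
  shows "\<exists>\<alpha>. 0 \<le> \<alpha> \<and> \<alpha> < 2 * pi \<and> (\<forall>\<theta>. geod y (gdir y x) \<theta> = geod x (gdir x y) (\<alpha> - \<theta>))"
proof (intro exI conjI allI)
  let ?\<alpha> = "arccos (x \<bullet> y)"
  let ?v = "gdir x y" and ?s = "gsin x y" and ?c = "x \<bullet> y"
  have c: "\<bar>x \<bullet> y\<bar> \<le> 1" using Cauchy_Schwarz_ineq2[of x y] assms by simp
  show "0 \<le> ?\<alpha>" using c by (intro arccos_lbound) auto
  show "?\<alpha> < 2 * pi" using arccos_ubound[of "x \<bullet> y"] c pi_gt_zero by linarith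
  have ca: "cos ?\<alpha> = ?c" using c by (simp add: cos_arccos_abs)
  have sa: "sin ?\<alpha> = ?s" using c by (simp add: sin_arccos_abs gsin_def)
  have "?s\<^sup>2 = 1 - ?c\<^sup>2"
    using c by (simp add: gsin_def abs_square_le_1)
  then have cs: "1 - ?c * ?c = ?s * ?s" by (simp add: power2_eq_square)
  have y: "y = ?c *\<^sub>R x + ?s *\<^sub>R ?v" using assms(3) by (simp add: gdir_def)
  have "x - (y \<bullet> x) *\<^sub>R y = x - ?c *\<^sub>R (?c *\<^sub>R x + ?s *\<^sub>R ?v)"
    by (simp only: y[symmetric] inner_commute[of y x])
  also have "\<dots> = (1 - ?c * ?c) *\<^sub>R x - (?c * ?s) *\<^sub>R ?v"
    by (simp add: algebra_simps)
  also have "\<dots> = ?s *\<^sub>R (?s *\<^sub>R x - ?c *\<^sub>R ?v)"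
    unfolding cs by (simp add: algebra_simps)
  finally have w: "gdir y x = ?s *\<^sub>R x - ?c *\<^sub>R ?v"
    using assms(3) by (simp add: gdir_def[of y x] gsin_commute[of y x])
  fix \<theta>
  have "geod y (gdir y x) \<theta> = cos \<theta> *\<^sub>R (?c *\<^sub>R x + ?s *\<^sub>R ?v) + sin \<theta> *\<^sub>R (?s *\<^sub>R x - ?c *\<^sub>R ?v)"
    unfolding geod_def w using y by simp
  also have "\<dots> = geod x ?v (?\<alpha> - \<theta>)"
    by (simp add: geod_def cos_diff sin_diff ca sa algebra_simps)
  finally show "geod y (gdir y x) \<theta> = geod x ?v (?\<alpha> - \<theta>)" .
qed

section \<open>Direction measures through isometries\<close>

lemma iso_properties:
  fixes x :: "'a::euclidean_space" and B :: "'b::euclidean_space itself"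
  assumes "DIM('b) + 1 = DIM('a)" "norm x = 1"
  shows "linear (iso B x)" "norm (iso B x y) = norm y" "range (iso B x) = {y. y \<bullet> x = 0}"
proof -
  have x: "x \<noteq> 0" using assms by auto
  have "subspace {y. y \<bullet> x = 0}"
    using subspace_hyperplane[of x] by (simp add: inner_commute)
  moreover have "dim (UNIV :: 'b set) = dim {y. y \<bullet> x = 0}"
    using dim_hyperplane[OF x] assms by (simp add: inner_commute)
  ultimately have "\<exists>f::'b \<Rightarrow> 'a. linear f \<and> (\<forall>y. norm (f y) = norm y) \<and> range f = {y. y \<bullet> x = 0}"
    using isometries_subspaces[OF subspace_UNIV, of "{y. y \<bullet> x = 0}"] by (metis UNIV_I)
  then have "linear (iso B x) \<and> (\<forall>y. norm (iso B x y) = norm y) \<and> range (iso B x) = {y. y \<bullet> x = 0}"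
    unfolding iso_def by (rule someI_ex)
  then show "linear (iso B x)" "norm (iso B x y) = norm y" "range (iso B x) = {y. y \<bullet> x = 0}"
    by blast+
qed

lemma space_mu[simp]: "space (mu B x) = subsph x"
  by (simp add: mu_def space_restrict_space)

lemma iso_measurable_subsph:
  fixes x :: "'a::euclidean_space" and B :: "'b::euclidean_space itself"
  assumes "DIM('b) + 1 = DIM('a)" "norm x = 1"
  shows "iso B x \<in> measurable surf (restrict_space borel (subsph x))"
proof (rule measurable_restrict_space2)
  show "iso B x \<in> space surf \<rightarrow> subsph x"
    using iso_properties[OF assms, of B] by (auto simp: subsph_def)
  show "iso B x \<in> borel_measurable surf"
    by (intro measurable_surf_of_borel borel_measurable_linear iso_properties assms)
qed

lemma nn_integral_mu:
  fixes x :: "'a::euclidean_space" and B :: "'b::euclidean_space itself"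
  assumes "DIM('b) + 1 = DIM('a)" "norm x = 1" and F: "F \<in> borel_measurable borel"
  shows "(\<integral>\<^sup>+v. F v \<partial>mu B x) = (\<integral>\<^sup>+u. F (iso B x u) \<partial>surf)"
  unfolding mu_def using iso_measurable_subsph[OF assms(1,2), of B] measurable_restrict_space1[OF F]
  by (intro nn_integral_distr) simp_all

lemma emeasure_mu:
  fixes x :: "'a::euclidean_space" and B :: "'b::euclidean_space itself"
  assumes "DIM('b) + 1 = DIM('a)" "norm x = 1"
  shows "emeasure (mu B x) (subsph x) = ennreal (omega B)"
  using nn_integral_mu[OF assms, of "\<lambda>_. 1" B] emeasure_surf_sphere_omega[of B]
  by simp

lemma measurable_mu_of_borel:
  "g \<in> measurable borel N \<Longrightarrow> g \<in> measurable (mu B x) N"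
  unfolding mu_def measurable_distr_eq1 by (rule measurable_restrict_space1)

text \<open>Extends the great-circle formula to integrands that see the direction as well as the
  point. The point determines the direction up to the sign of sin \<theta>, and evenness of h
  absorbs that sign. The right side no longer mentions the chosen isometry.\<close>

lemma great_circle_mu:
  fixes x :: "'a::euclidean_space" and B :: "'b::euclidean_space itself"
  assumes dim: "DIM('b) + 1 = DIM('a)" "2 \<le> DIM('b)" and x: "norm x = 1"
    and [measurable]: "(\<lambda>(v, y). h v y) \<in> borel_measurable (borel \<Otimes>\<^sub>M borel)"
    and even: "\<And>v y. h (- v) y = h v y"
  shows "(\<integral>\<^sup>+v. \<integral>\<^sup>+\<theta>. ennreal (\<bar>sin \<theta>\<bar> ^ (DIM('b) - 1)) * indicator {0..<2*pi} \<theta> * h v (geod x v \<theta>) \<partial>lborel \<partial>mu B x)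
    = 2 * (\<integral>\<^sup>+y. h (gdir x y) y \<partial>surf)"
proof -
  note iso = iso_properties[OF dim(1) x, of B]
  have "2 * (\<integral>\<^sup>+y. h (gdir x y) y \<partial>surf)
    = (\<integral>\<^sup>+u. \<integral>\<^sup>+\<theta>. ennreal (\<bar>sin \<theta>\<bar> ^ (DIM('b) - 1)) * indicator {0..<2*pi} \<theta>
         * h (gdir x (geod x (iso B x u) \<theta>)) (geod x (iso B x u) \<theta>) \<partial>lborel \<partial>surf)"
    unfolding geod_def by (rule nn_integral_surf_great_circle[OF x iso dim]) measurable
  also have "\<dots> = (\<integral>\<^sup>+u. \<integral>\<^sup>+\<theta>. ennreal (\<bar>sin \<theta>\<bar> ^ (DIM('b) - 1)) * indicator {0..<2*pi} \<theta>
         * h (iso B x u) (geod x (iso B x u) \<theta>) \<partial>lborel \<partial>surf)"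
  proof (rule nn_integral_cong, rule nn_integral_cong)
    fix u \<theta>
    have o: "iso B x u \<bullet> x = 0" using iso(3) by auto
    show "ennreal (\<bar>sin \<theta>\<bar> ^ (DIM('b) - 1)) * indicator {0..<2*pi} \<theta>
         * h (gdir x (geod x (iso B x u) \<theta>)) (geod x (iso B x u) \<theta>)
       = ennreal (\<bar>sin \<theta>\<bar> ^ (DIM('b) - 1)) * indicator {0..<2*pi} \<theta>
         * h (iso B x u) (geod x (iso B x u) \<theta>)"
    proof (cases "sin \<theta> = 0")
      \<comment> \<open>At the poles the direction cannot be recovered, but the weight is zero there
        because its exponent is positive.\<close>
      case True
      then have "ennreal (\<bar>sin \<theta>\<bar> ^ (DIM('b) - 1)) = 0"
        using dim(2) by (simp add: power_0_left)
      then show ?thesis by (simp only: mult_zero_left)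
    next
      case False
      then have "sgn (sin \<theta>) = 1 \<or> sgn (sin \<theta>) = -1" by (auto simp: sgn_real_def)
      then show ?thesis using gdir_geod[OF x o False] even by auto
    qed
  qed
  also have "\<dots> = (\<integral>\<^sup>+v. \<integral>\<^sup>+\<theta>. ennreal (\<bar>sin \<theta>\<bar> ^ (DIM('b) - 1)) * indicator {0..<2*pi} \<theta> * h v (geod x v \<theta>) \<partial>lborel \<partial>mu B x)"
    by (rule nn_integral_mu[OF dim(1) x, symmetric]) measurable
  finally show ?thesis ..
qed

lemma AE_sin_nonzero: "AE \<theta> in lborel. \<theta> \<in> {0..<2*pi} \<longrightarrow> sin \<theta> \<noteq> 0"
proof -
  have "AE \<theta> in lborel. \<theta> \<noteq> 0" "AE \<theta> in lborel. \<theta> \<noteq> pi"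
    by (rule AE_lborel_singleton)+
  then show ?thesis
  proof eventually_elim
    case (elim \<theta>)
    show ?case
    proof
      assume \<theta>: "\<theta> \<in> {0..<2*pi}"
      show "sin \<theta> \<noteq> 0"
      proof (cases "\<theta> < pi")
        case True
        then show ?thesis using sin_gt_zero[of \<theta>] elim \<theta> by auto
      next
        case False
        then show ?thesis using sin_gt_zero[of "\<theta> - pi"] elim \<theta> by (auto simp: sin_diff)
      qed
    qed
  qed
qed

section \<open>Level sets along great circles and their symmetry\<close>

locale geodesic_slice =
  fixes p :: "'a::euclidean_space \<Rightarrow> real" and B :: "'b::euclidean_space itself"
  assumes p_measurable[measurable]: "p \<in> borel_measurable borel"
    and p_pos: "\<And>x. 0 < p x"
    and dim: "DIM('b) + 1 = DIM('a)" and dim2: "2 \<le> DIM('b)"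
begin

definition len :: "'a \<Rightarrow> 'a \<Rightarrow> real \<Rightarrow> ennreal" where
  "len x v t = emeasure lborel (lvl p x v t)"

lemma lvl_sets[measurable]: "lvl p x v t \<in> sets borel"
proof -
  have "lvl p x v t = {\<theta> \<in> space borel. 0 \<le> \<theta> \<and> \<theta> < 2 * pi \<and> p (geod x v \<theta>) > t}"
    by (auto simp: lvl_def)
  then show ?thesis by simp
qed

lemma len_eq: "len x v t = (\<integral>\<^sup>+\<theta>. indicator {0..<2*pi} \<theta> * indicator {t<..} (p (geod x v \<theta>)) \<partial>lborel)"
proof -
  have "len x v t = (\<integral>\<^sup>+\<theta>. indicator (lvl p x v t) \<theta> \<partial>lborel)"
    by (simp add: len_def)
  also have "\<dots> = (\<integral>\<^sup>+\<theta>. indicator {0..<2*pi} \<theta> * indicator {t<..} (p (geod x v \<theta>)) \<partial>lborel)"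
    by (intro nn_integral_cong) (auto simp: lvl_def indicator_def)
  finally show ?thesis .
qed

lemma len_measurable[measurable (raw)]:
  assumes [measurable]: "f \<in> borel_measurable M" "g \<in> borel_measurable M" "h \<in> borel_measurable M"
  shows "(\<lambda>\<omega>. len (f \<omega>) (g \<omega>) (h \<omega>)) \<in> borel_measurable M"
proof -
  have "(\<lambda>\<omega>. len (f \<omega>) (g \<omega>) (h \<omega>))
    = (\<lambda>\<omega>. \<integral>\<^sup>+\<theta>. indicator {0..<2*pi} \<theta> * (if h \<omega> < p (geod (f \<omega>) (g \<omega>) \<theta>) then 1 else 0) \<partial>lborel)"
    unfolding len_eq by (intro ext nn_integral_cong) (auto simp: indicator_def)
  also have "\<dots> \<in> borel_measurable M" by measurable
  finally show ?thesis .
qed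

lemma len_le: "len x v t \<le> ennreal (2 * pi)"
proof -
  have "len x v t \<le> emeasure lborel {0..<2*pi}"
    unfolding len_def by (intro emeasure_mono) (auto simp: lvl_def)
  then show ?thesis by simp
qed

text \<open>The length of a level set belongs to the great circle, not to its base point or
  orientation. The case \<alpha> = 0 gives evenness in v, and \<alpha> equal to the angle between x
  and y gives symmetry.\<close>

lemma len_reflect:
  assumes "0 \<le> \<alpha>" "\<alpha> < 2 * pi" "\<And>\<theta>. geod y w \<theta> = geod x v (\<alpha> - \<theta>)"
  shows "len y w t = len x v t"
  unfolding len_eq assms(3)
  by (rule nn_integral_periodic_reflect[OF _ _ assms(1,2)]) (simp_all add: geod_def)

lemma len_minus[simp]: "len x (- v) t = len x v t"
  by (rule len_reflect[of 0]) (simp_all add: geod_minus)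

lemma len_commute:
  assumes "norm x = 1" "norm y = 1" "gsin x y \<noteq> 0"
  shows "len y (gdir y x) t = len x (gdir x y) t"
  using geod_gdir_commute[OF assms] len_reflect by blast

text \<open>Up to the factor \<open>2 / (p x \<omega>\<^sub>d\<^sub>-\<^sub>2)\<close> this is the density of \<open>H(x, \<cdot>)\<close> with respect to
  \<open>\<sigma>\<^sub>d\<^sub>-\<^sub>1\<close>; its symmetry is the reversibility of the kernel.\<close>

definition sym_dens :: "'a \<Rightarrow> 'a \<Rightarrow> ennreal" where
  "sym_dens x y = (\<integral>\<^sup>+t. indicator {0<..} t * (if t < p x then 1 else 0) * (if t < p y then 1 else 0)
      * inverse (len x (gdir x y) t) * inverse (ennreal (gsin x y ^ (DIM('b) - 1))) \<partial>lborel)"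

lemma sym_dens_measurable[measurable (raw)]:
  assumes [measurable]: "f \<in> borel_measurable M" "g \<in> borel_measurable M"
  shows "(\<lambda>\<omega>. sym_dens (f \<omega>) (g \<omega>)) \<in> borel_measurable M"
  unfolding sym_dens_def by measurable

lemma sym_dens_commute:
  assumes "norm x = 1" "norm y = 1" "gsin x y \<noteq> 0"
  shows "sym_dens x y = sym_dens y x"
  unfolding sym_dens_def len_commute[OF assms] gsin_commute[of y x] by (simp add: mult_ac)

text \<open>In great-circle coordinates \<open>gsin\<close> is |sin \<theta>|, so the weight
  vanishes exactly where the indicator of the poles is one.\<close>

lemma AE_gsin_nonzero:
  fixes x :: 'a
  assumes "norm x = 1"
  shows "AE y in surf. gsin x y \<noteq> 0"
proof -
  have "2 * (\<integral>\<^sup>+y. (if gsin x y = 0 then 1 else 0) \<partial>surf) =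
     (\<integral>\<^sup>+v. \<integral>\<^sup>+\<theta>. ennreal (\<bar>sin \<theta>\<bar> ^ (DIM('b) - 1)) * indicator {0..<2*pi} \<theta> * (if gsin x (geod x v \<theta>) = 0 then 1 else 0) \<partial>lborel \<partial>mu B x)"
    by (rule great_circle_mu[OF dim dim2 assms, symmetric]) simp_all
  also have "\<dots> = (\<integral>\<^sup>+v. \<integral>\<^sup>+\<theta>. 0 \<partial>(lborel :: real measure) \<partial>mu B x)"
  proof (rule nn_integral_cong, rule nn_integral_cong)
    fix v \<theta> assume "v \<in> space (mu B x)"
    then have "gsin x (geod x v \<theta>) = \<bar>sin \<theta>\<bar>" by (intro gsin_geod[OF assms]) (simp add: subsph_def)
    then show "ennreal (\<bar>sin \<theta>\<bar> ^ (DIM('b) - 1)) * indicator {0..<2*pi} \<theta> * (if gsin x (geod x v \<theta>) = 0 then 1 else 0) = 0"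
      using dim2 by (cases "sin \<theta> = 0") (simp_all add: power_0_left)
  qed
  finally have "(\<integral>\<^sup>+y. (if gsin x y = 0 then 1 else 0) \<partial>surf) = (0::ennreal)" by simp
  then have "AE y in surf. (if gsin x y = 0 then 1 else 0) = (0::ennreal)"
    by (subst (asm) nn_integral_0_iff_AE) (rule measurable_surf_of_borel, measurable)
  then show ?thesis by eventually_elim (auto split: if_splits)
qed

text \<open>The great-circle formula for the constant 1. It shows that the sine weight has nonzero
  integral, as \<open>Hwd_iff\<close> requires, and links the volumes of the two spheres.\<close>

lemma sin_weight:
  fixes x :: 'a
  assumes "norm x = 1"
  shows "(\<integral>\<^sup>+\<theta>. ennreal (\<bar>sin \<theta>\<bar> ^ (DIM('b) - 1)) * indicator {0..<2*pi} \<theta> \<partial>lborel) * ennreal (omega B)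
     = 2 * ennreal (omega TYPE('a))"
proof -
  have "2 * (\<integral>\<^sup>+y. 1 \<partial>(surf :: 'a measure)) =
     (\<integral>\<^sup>+v. \<integral>\<^sup>+\<theta>. ennreal (\<bar>sin \<theta>\<bar> ^ (DIM('b) - 1)) * indicator {0..<2*pi} \<theta> * 1 \<partial>lborel \<partial>mu B x)"
    by (rule great_circle_mu[OF dim dim2 assms, symmetric]) simp_all
  then show ?thesis
    by (simp add: emeasure_mu[OF dim assms] emeasure_surf_sphere_omega[of "TYPE('a)"])
qed

text \<open>The sine weight is at most 1 on a circle of length 2 pi. The inequality makes the term
  subtracted in \<rho> at most 1/2 and gives the minorization at points where H is the uniform
  law.\<close>

lemma omega_le: "omega TYPE('a) \<le> pi * omega B"
proof -
  obtain x :: 'a where x: "norm x = 1" using vector_choose_size[of 1] by auto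
  let ?c = "\<integral>\<^sup>+\<theta>. ennreal (\<bar>sin \<theta>\<bar> ^ (DIM('b) - 1)) * indicator {0..<2*pi} \<theta> \<partial>lborel"
  have "?c \<le> (\<integral>\<^sup>+\<theta>. indicator {0..<2*pi} \<theta> \<partial>lborel)"
    by (intro nn_integral_mono) (auto simp: indicator_def power_le_one)
  also have "\<dots> = ennreal (2 * pi)" by simp
  finally have "2 * ennreal (omega TYPE('a)) \<le> ennreal (2 * pi) * ennreal (omega B)"
    unfolding sin_weight[OF x, symmetric] by (rule mult_right_mono) simp
  then have "ennreal (2 * omega TYPE('a)) \<le> ennreal (2 * pi * omega B)"
    using omega_pos[of B] omega_pos[of "TYPE('a)"] by (simp add: ennreal_mult)
  then show ?thesis using omega_pos[of B] by (simp add: ennreal_le_iff)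
qed

end

lemma sets_sph_space_imp_borel: "A \<in> sets sph_space \<Longrightarrow> A \<in> sets borel"
  by (auto simp: sets_restrict_space)

section \<open>The density of the kernel and almost sure well-definedness\<close>

context geodesic_slice
begin

definition slice_dens :: "'a \<Rightarrow> 'a \<Rightarrow> ennreal" where
  "slice_dens x y = ennreal (2 / (p x * omega B)) * sym_dens x y"

lemma slice_dens_measurable[measurable (raw)]:
  assumes [measurable]: "f \<in> borel_measurable M" "g \<in> borel_measurable M"
  shows "(\<lambda>\<omega>. slice_dens (f \<omega>) (g \<omega>)) \<in> borel_measurable M"
  unfolding slice_dens_def by measurable

text \<open>The sampler draws \<theta> without a sine weight. The weight is inserted together with
  its inverse, which is \<open>gsin\<close> of the end point to the power -(d-2); the two cancel
  outside a null set of angles.\<close>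

lemma level_average:
  fixes x :: 'a
  assumes x: "norm x = 1" and [measurable]: "A \<in> sets borel"
  shows "(\<integral>\<^sup>+v. (1 / emeasure lborel (lvl p x v t)) *
            (\<integral>\<^sup>+ \<theta> \<in> lvl p x v t. indicator A (geod x v \<theta>) \<partial>lborel) \<partial>mu B x)
     = 2 * (\<integral>\<^sup>+y. indicator A y * ((if t < p y then 1 else 0)
          * inverse (len x (gdir x y) t) * inverse (ennreal (gsin x y ^ (DIM('b) - 1)))) \<partial>surf)"
proof -
  define h where "h = (\<lambda>v y. indicator A y * ((if t < p y then 1 else 0)
          * inverse (len x v t) * inverse (ennreal (gsin x y ^ (DIM('b) - 1)))))"
  have [measurable]: "(\<lambda>(v, y). h v y) \<in> borel_measurable (borel \<Otimes>\<^sub>M borel)"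
    unfolding h_def by measurable
  have "(\<integral>\<^sup>+v. (1 / emeasure lborel (lvl p x v t)) *
            (\<integral>\<^sup>+ \<theta> \<in> lvl p x v t. indicator A (geod x v \<theta>) \<partial>lborel) \<partial>mu B x)
    = (\<integral>\<^sup>+v. \<integral>\<^sup>+\<theta>. ennreal (\<bar>sin \<theta>\<bar> ^ (DIM('b) - 1)) * indicator {0..<2*pi} \<theta> * h v (geod x v \<theta>) \<partial>lborel \<partial>mu B x)"
  proof (rule nn_integral_cong)
    fix v assume "v \<in> space (mu B x)"
    then have o: "v \<bullet> x = 0" by (simp add: subsph_def)
    \<comment> \<open>The reciprocal length may be infinite. In \<open>ennreal\<close> it still
      moves under the integral, with infinity times 0 equal to 0, so level sets of length zero need
      no separate case.\<close>
    have "(1 / emeasure lborel (lvl p x v t)) * (\<integral>\<^sup>+ \<theta> \<in> lvl p x v t. indicator A (geod x v \<theta>) \<partial>lborel)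
      = (\<integral>\<^sup>+ \<theta>. inverse (len x v t) * (indicator A (geod x v \<theta>) * indicator (lvl p x v t) \<theta>) \<partial>lborel)"
      by (subst nn_integral_cmult) (simp_all add: len_def divide_ennreal_def)
    also have "\<dots> = (\<integral>\<^sup>+\<theta>. ennreal (\<bar>sin \<theta>\<bar> ^ (DIM('b) - 1)) * indicator {0..<2*pi} \<theta> * h v (geod x v \<theta>) \<partial>lborel)"
    proof (rule nn_integral_cong_AE)
      show "AE \<theta> in lborel. inverse (len x v t) * (indicator A (geod x v \<theta>) * indicator (lvl p x v t) \<theta>)
        = ennreal (\<bar>sin \<theta>\<bar> ^ (DIM('b) - 1)) * indicator {0..<2*pi} \<theta> * h v (geod x v \<theta>)"
        using AE_sin_nonzero
      proof eventually_elim
        case (elim \<theta>)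
        show ?case
        proof (cases "\<theta> \<in> {0..<2*pi}")
          case False
          then show ?thesis by (auto simp: lvl_def indicator_def)
        next
          case True
          let ?a = "ennreal (\<bar>sin \<theta>\<bar> ^ (DIM('b) - 1))"
          have "?a * inverse ?a = 1"
            using elim True by (simp add: divide_ennreal_def[symmetric])
          then have "?a * h v (geod x v \<theta>) = indicator A (geod x v \<theta>) * ((if t < p (geod x v \<theta>) then 1 else 0) * inverse (len x v t))"
            unfolding h_def gsin_geod[OF x o] by (simp add: mult_ac)
          then show ?thesis using True by (auto simp: lvl_def indicator_def mult_ac)
        qed
      qed
    qed
    finally show "(1 / emeasure lborel (lvl p x v t)) * (\<integral>\<^sup>+ \<theta> \<in> lvl p x v t. indicator A (geod x v \<theta>) \<partial>lborel)
      = (\<integral>\<^sup>+\<theta>. ennreal (\<bar>sin \<theta>\<bar> ^ (DIM('b) - 1)) * indicator {0..<2*pi} \<theta> * h v (geod x v \<theta>) \<partial>lborel)" .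
  qed
  also have "\<dots> = 2 * (\<integral>\<^sup>+y. h (gdir x y) y \<partial>surf)"
    by (rule great_circle_mu[OF dim dim2 x]) (simp_all add: h_def)
  finally show ?thesis by (simp add: h_def)
qed

text \<open>The outer integral contributes \<open>t < p x\<close> and the level set contributes
  \<open>t < p y\<close>; exchanging the integrals over t and y collects both in
  \<open>sym_dens\<close>. The length is never cancelled, so the identity holds at every unit
  vector, well defined or not.\<close>

lemma Hval_eq:
  fixes x :: 'a
  assumes x: "norm x = 1" and [measurable]: "A \<in> sets borel"
  shows "Hval B p x A = (\<integral>\<^sup>+y. slice_dens x y * indicator A y \<partial>surf)"
proof -
  define H where "H = (\<lambda>y t. indicator {0<..} t * (if t < p x then 1 else 0) * (if t < p y then 1 else 0)
      * inverse (len x (gdir x y) t) * inverse (ennreal (gsin x y ^ (DIM('b) - 1))))"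
  have [measurable]: "(\<lambda>(y, t). H y t) \<in> borel_measurable (borel \<Otimes>\<^sub>M borel)"
    unfolding H_def by measurable
  have inner: "(ennreal (1 / omega B) * (\<integral>\<^sup>+v. (1 / emeasure lborel (lvl p x v t)) *
            (\<integral>\<^sup>+ \<theta> \<in> lvl p x v t. indicator A (geod x v \<theta>) \<partial>lborel) \<partial>mu B x)) * indicator {0<..<p x} t
     = ennreal (2 / omega B) * (\<integral>\<^sup>+y. indicator A y * H y t \<partial>surf)" for t
  proof (cases "0 < t \<and> t < p x")
    case False
    then show ?thesis by (auto simp: H_def indicator_def)
  next
    case True
    have "ennreal (1 / omega B) * 2 = ennreal (2 / omega B)"
      using omega_pos[of B] by (simp add: ennreal_mult'[symmetric] flip: ennreal_numeral)
    then show ?thesis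
      using True unfolding level_average[OF assms] by (simp add: H_def mult.assoc[symmetric])
  qed
  have "Hval B p x A = ennreal (1 / p x) * (\<integral>\<^sup>+t. ennreal (2 / omega B) * (\<integral>\<^sup>+y. indicator A y * H y t \<partial>surf) \<partial>lborel)"
    unfolding Hval_def inner ..
  also have "\<dots> = ennreal (1 / p x) * (ennreal (2 / omega B) * (\<integral>\<^sup>+t. \<integral>\<^sup>+y. indicator A y * H y t \<partial>surf \<partial>lborel))"
    by (subst nn_integral_cmult) simp_all
  also have "\<dots> = ennreal (2 / (p x * omega B)) * (\<integral>\<^sup>+t. \<integral>\<^sup>+y. indicator A y * H y t \<partial>surf \<partial>lborel)"
    using omega_pos[of B] p_pos[of x] by (simp add: mult.assoc[symmetric] ennreal_mult[symmetric])
  also have "(\<integral>\<^sup>+t. \<integral>\<^sup>+y. indicator A y * H y t \<partial>surf \<partial>lborel) = (\<integral>\<^sup>+y. \<integral>\<^sup>+t. indicator A y * H y t \<partial>lborel \<partial>surf)"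
    by (rule Fubini_surf_lborel) simp
  also have "\<dots> = (\<integral>\<^sup>+y. indicator A y * sym_dens x y \<partial>surf)"
    by (rule nn_integral_cong) (subst nn_integral_cmult, simp_all add: sym_dens_def H_def)
  also have "ennreal (2 / (p x * omega B)) * \<dots> = (\<integral>\<^sup>+y. ennreal (2 / (p x * omega B)) * (indicator A y * sym_dens x y) \<partial>surf)"
    by (rule nn_integral_cmult[symmetric]) (rule measurable_surf_of_borel, simp)
  finally show ?thesis by (simp add: slice_dens_def mult_ac)
qed

text \<open>Degenerate levels are indexed by an end point y instead of a direction v, so that
  well-definedness can be expressed by measures that do not depend on x.\<close>

definition degen :: "'a \<Rightarrow> real \<Rightarrow> 'a \<Rightarrow> ennreal" where
  "degen x t y = (if 0 < t \<and> t < p x \<and> len x (gdir x y) t = 0 then 1 else 0)"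

lemma degen_measurable[measurable (raw)]:
  assumes [measurable]: "f \<in> borel_measurable M" "g \<in> borel_measurable M" "h \<in> borel_measurable M"
  shows "(\<lambda>\<omega>. degen (f \<omega>) (g \<omega>) (h \<omega>)) \<in> borel_measurable M"
  unfolding degen_def by measurable

text \<open>A null set of directions for \<open>mu B x\<close> corresponds to a null set of end
  points for \<open>surf\<close>. Well-definedness becomes the vanishing of a parameter integral,
  from which its measurability in x follows.\<close>

lemma Hwd_iff:
  fixes x :: 'a
  assumes x: "norm x = 1"
  shows "Hwd B p x \<longleftrightarrow> (\<integral>\<^sup>+t. \<integral>\<^sup>+y. degen x t y \<partial>surf \<partial>lborel) = (0::ennreal)"
proof -
  define W where "W = (\<integral>\<^sup>+\<theta>. ennreal (\<bar>sin \<theta>\<bar> ^ (DIM('b) - 1)) * indicator {0..<2*pi} \<theta> \<partial>lborel)"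
  have W: "W \<noteq> 0"
    using sin_weight[OF x] omega_pos[of "TYPE('a)"] by (auto simp: W_def)
  have *: "(AE v in mu B x. 0 < emeasure lborel (lvl p x v t)) \<longleftrightarrow>
      (\<integral>\<^sup>+y. (if len x (gdir x y) t = 0 then 1 else 0) \<partial>surf) = (0::ennreal)" for t
  proof -
    have "(AE v in mu B x. 0 < emeasure lborel (lvl p x v t)) \<longleftrightarrow> (AE v in mu B x. (if len x v t = 0 then 1 else 0) = (0::ennreal))"
      by (intro arg_cong2[where f = eventually] refl ext) (auto simp: len_def zero_less_iff_neq_zero)
    also have "\<dots> \<longleftrightarrow> (\<integral>\<^sup>+v. (if len x v t = 0 then 1 else 0) \<partial>mu B x) = (0::ennreal)"
      by (subst nn_integral_0_iff_AE) (rule measurable_mu_of_borel, simp_all)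
    \<comment> \<open>The nonzero factor \<open>W\<close> supplies the angular integral missing from
      the left side of the great-circle formula; the integrand does not depend on \<theta>.\<close>
    also have "\<dots> \<longleftrightarrow> W * (\<integral>\<^sup>+v. (if len x v t = 0 then 1 else 0) \<partial>mu B x) = (0::ennreal)"
      using W by simp
    also have "W * (\<integral>\<^sup>+v. (if len x v t = 0 then 1 else 0) \<partial>mu B x) = (\<integral>\<^sup>+v. W * (if len x v t = 0 then 1 else 0) \<partial>mu B x)"
      by (rule nn_integral_cmult[symmetric]) (rule measurable_mu_of_borel, simp)
    also have "\<dots> = (\<integral>\<^sup>+v. \<integral>\<^sup>+\<theta>. ennreal (\<bar>sin \<theta>\<bar> ^ (DIM('b) - 1)) * indicator {0..<2*pi} \<theta> * (if len x v t = 0 then 1 else 0) \<partial>lborel \<partial>mu B x)"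
      unfolding W_def by (rule nn_integral_cong) (subst nn_integral_multc, simp_all)
    also have "\<dots> = 2 * (\<integral>\<^sup>+y. (if len x (gdir x y) t = 0 then 1 else 0) \<partial>surf)"
      by (rule great_circle_mu[OF dim dim2 x]) simp_all
    finally show ?thesis by simp
  qed
  have "Hwd B p x \<longleftrightarrow> (AE t in lborel. (\<integral>\<^sup>+y. degen x t y \<partial>surf) = (0::ennreal))"
    unfolding Hwd_def *
  proof (intro arg_cong2[where f = eventually] refl ext)
    fix t
    show "(0 < t \<and> t < p x \<longrightarrow> (\<integral>\<^sup>+y. (if len x (gdir x y) t = 0 then 1 else 0) \<partial>surf) = (0::ennreal)) \<longleftrightarrow>
      (\<integral>\<^sup>+y. degen x t y \<partial>surf) = (0::ennreal)"
      by (cases "0 < t"; cases "t < p x") (simp_all add: degen_def)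
  qed
  also have "\<dots> \<longleftrightarrow> (\<integral>\<^sup>+t. \<integral>\<^sup>+y. degen x t y \<partial>surf \<partial>lborel) = (0::ennreal)"
    by (rule nn_integral_0_iff_AE[symmetric]) measurable
  finally show ?thesis .
qed

lemma Hwd_measurable[measurable]: "Measurable.pred sph_space (Hwd B p)"
proof -
  have "Measurable.pred sph_space (\<lambda>x. (\<integral>\<^sup>+t. \<integral>\<^sup>+y. degen x t y \<partial>surf \<partial>lborel) = (0::ennreal))"
    by (rule measurable_restrict_space1) measurable
  from measurable_cong[THEN iffD2, OF _ this] show ?thesis
    by (simp add: Hwd_iff space_restrict_space)
qed

text \<open>The roles are exchanged: y and t are fixed and x varies. A degenerate x satisfies t < p
  x, so it lies in the level set of its great circle through y, and by \<open>len_commute\<close>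
  that set has length zero also when measured from y. Such x therefore occupy a null set of angles
  on each circle through y.\<close>

lemma AE_Hwd: "AE x in surf. Hwd B p x"
proof -
  have null: "(\<integral>\<^sup>+x. degen x t y \<partial>surf) = 0" if y: "y \<in> sphere 0 1" for t y
  proof -
    from y have y: "norm y = 1" by simp
    have "2 * (\<integral>\<^sup>+x. degen x t y \<partial>surf) = 2 * (\<integral>\<^sup>+x. (if 0 < t \<and> t < p x \<and> len y (gdir y x) t = 0 then 1 else 0) \<partial>surf)"
    proof -
      have "AE x in surf. degen x t y = (if 0 < t \<and> t < p x \<and> len y (gdir y x) t = 0 then 1 else 0)"
        using AE_gsin_nonzero[OF y] AE_space
      proof eventually_elim
        case (elim x)
        then show ?case using len_commute[OF y, of x t] by (simp add: degen_def)
      qed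
      then show ?thesis by (simp cong: nn_integral_cong_AE)
    qed
    also have "\<dots> = (\<integral>\<^sup>+v. \<integral>\<^sup>+\<theta>. ennreal (\<bar>sin \<theta>\<bar> ^ (DIM('b) - 1)) * indicator {0..<2*pi} \<theta> *
       (if 0 < t \<and> t < p (geod y v \<theta>) \<and> len y v t = 0 then 1 else 0) \<partial>lborel \<partial>mu B y)"
      by (rule great_circle_mu[OF dim dim2 y, symmetric]) simp_all
    also have "\<dots> = (\<integral>\<^sup>+v. 0 \<partial>mu B y)"
    proof (rule nn_integral_cong)
      fix v
      show "(\<integral>\<^sup>+\<theta>. ennreal (\<bar>sin \<theta>\<bar> ^ (DIM('b) - 1)) * indicator {0..<2*pi} \<theta> *
         (if 0 < t \<and> t < p (geod y v \<theta>) \<and> len y v t = 0 then 1 else 0) \<partial>lborel) = 0"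
      proof (cases "len y v t = 0")
        case True
        \<comment> \<open>With sine weight at most 1, the angles at which the integrand is nonzero
          lie in the level set itself.\<close>
        have "(\<integral>\<^sup>+\<theta>. ennreal (\<bar>sin \<theta>\<bar> ^ (DIM('b) - 1)) * indicator {0..<2*pi} \<theta> *
            (if 0 < t \<and> t < p (geod y v \<theta>) \<and> len y v t = 0 then 1 else 0) \<partial>lborel) \<le> len y v t"
          unfolding len_eq by (intro nn_integral_mono) (auto simp: indicator_def power_le_one)
        then show ?thesis using True by simp
      qed simp
    qed
    finally show ?thesis by simp
  qed
  have "(\<integral>\<^sup>+x. \<integral>\<^sup>+t. \<integral>\<^sup>+y. degen x t y \<partial>surf \<partial>lborel \<partial>surf) = (\<integral>\<^sup>+t. \<integral>\<^sup>+x. \<integral>\<^sup>+y. degen x t y \<partial>surf \<partial>surf \<partial>lborel)"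
    by (rule Fubini_surf_lborel[symmetric]) simp
  also have "\<dots> = (\<integral>\<^sup>+t. \<integral>\<^sup>+y. \<integral>\<^sup>+x. degen x t y \<partial>surf \<partial>surf \<partial>lborel)"
    by (rule nn_integral_cong) (rule Fubini_surf_surf[symmetric], simp)
  also have "\<dots> = (\<integral>\<^sup>+t. \<integral>\<^sup>+y. 0 \<partial>(surf :: 'a measure) \<partial>(lborel :: real measure))"
    by (rule nn_integral_cong, rule nn_integral_cong) (simp add: null)
  finally have "(\<integral>\<^sup>+x. \<integral>\<^sup>+t. \<integral>\<^sup>+y. degen x t y \<partial>surf \<partial>lborel \<partial>surf) = 0" by simp
  then have "AE x in surf. (\<integral>\<^sup>+t. \<integral>\<^sup>+y. degen x t y \<partial>surf \<partial>lborel) = 0"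
    by (subst (asm) nn_integral_0_iff_AE) (rule measurable_surf_of_borel, simp)
  then show ?thesis
    using AE_space
  proof eventually_elim
    case (elim x)
    then show ?case using Hwd_iff[of x] by simp
  qed
qed

text \<open>Taking the whole space as target, almost every inner average is 1. Positive length is
  well-definedness, finite length is \<open>len_le\<close>, and together they permit the
  cancellation.\<close>

lemma slice_dens_integral:
  fixes x :: 'a
  assumes x: "norm x = 1" and wd: "Hwd B p x"
  shows "(\<integral>\<^sup>+y. slice_dens x y \<partial>surf) = 1"
proof -
  have "(\<integral>\<^sup>+y. slice_dens x y \<partial>surf) = Hval B p x UNIV"
    by (simp add: Hval_eq[OF x])
  also have "\<dots> = ennreal (1 / p x) * (\<integral>\<^sup>+t. indicator {0<..<p x} t \<partial>lborel)"
    unfolding Hval_def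
  proof (intro arg_cong2[where f = "(*)"] refl nn_integral_cong_AE)
    show "AE t in lborel. ennreal (1 / omega B) * (\<integral>\<^sup>+v. (1 / emeasure lborel (lvl p x v t)) *
            (\<integral>\<^sup>+ \<theta> \<in> lvl p x v t. indicator UNIV (geod x v \<theta>) \<partial>lborel) \<partial>mu B x) * indicator {0<..<p x} t = indicator {0<..<p x} t"
      using wd unfolding Hwd_def
    proof eventually_elim
      case (elim t)
      show ?case
      proof (cases "t \<in> {0<..<p x}")
        case True
        with elim have AE: "AE v in mu B x. 0 < emeasure lborel (lvl p x v t)" by simp
        have "(\<integral>\<^sup>+v. (1 / emeasure lborel (lvl p x v t)) *
            (\<integral>\<^sup>+ \<theta> \<in> lvl p x v t. indicator UNIV (geod x v \<theta>) \<partial>lborel) \<partial>mu B x) = (\<integral>\<^sup>+v. 1 \<partial>mu B x)"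
        proof (rule nn_integral_cong_AE)
          show "AE v in mu B x. (1 / emeasure lborel (lvl p x v t)) *
            (\<integral>\<^sup>+ \<theta> \<in> lvl p x v t. indicator UNIV (geod x v \<theta>) \<partial>lborel) = 1"
            using AE
          proof eventually_elim
            case (elim v)
            have "emeasure lborel (lvl p x v t) < top"
              using len_le[of x v t] by (simp add: len_def order_le_less_trans[OF _ ennreal_less_top])
            then show ?case using elim
              by (simp add: ennreal_times_divide[symmetric] mult.commute[of "1 / _"] ennreal_times_divide)
          qed
        qed
        also have "\<dots> = ennreal (omega B)"
          by (simp add: emeasure_mu[OF dim x])
        finally show ?thesis
          using omega_pos[of B] by (simp add: ennreal_mult[symmetric])
      qed simp
    qed
  qed
  also have "\<dots> = 1"
    using p_pos[of x] by (simp add: ennreal_mult[symmetric])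
  finally show ?thesis .
qed

end

section \<open>Contraction by minorization\<close>

lemma nn_integral_layer_cake:
  fixes g :: "'a \<Rightarrow> real"
  assumes "sigma_finite_measure M" and [measurable]: "g \<in> borel_measurable M"
    and g: "\<And>x. x \<in> space M \<Longrightarrow> 0 \<le> g x" "\<And>x. x \<in> space M \<Longrightarrow> g x \<le> D"
  shows "(\<integral>\<^sup>+x. ennreal (g x) \<partial>M) = (\<integral>\<^sup>+s. emeasure M {x \<in> space M. s < g x} * indicator {0..<D} s \<partial>lborel)"
proof -
  interpret P: pair_sigma_finite M "lborel :: real measure"
    by (simp add: pair_sigma_finite_def assms(1) lborel.sigma_finite_measure_axioms)
  have "(\<integral>\<^sup>+x. ennreal (g x) \<partial>M) = (\<integral>\<^sup>+x. \<integral>\<^sup>+s. (if s < g x then 1 else 0) * indicator {0..<D} s \<partial>lborel \<partial>M)"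
  proof (rule nn_integral_cong)
    fix x assume x: "x \<in> space M"
    have "(\<integral>\<^sup>+s. (if s < g x then 1 else 0) * indicator {0..<D} s \<partial>lborel) = (\<integral>\<^sup>+s. indicator {0..<g x} s \<partial>lborel)"
      using g[OF x] by (intro nn_integral_cong) (auto simp: indicator_def)
    then show "ennreal (g x) = (\<integral>\<^sup>+s. (if s < g x then 1 else 0) * indicator {0..<D} s \<partial>lborel)"
      using g[OF x] by simp
  qed
  also have "\<dots> = (\<integral>\<^sup>+s. \<integral>\<^sup>+x. (if s < g x then 1 else 0) * indicator {0..<D} s \<partial>M \<partial>lborel)"
    by (rule P.Fubini'[symmetric]) measurable
  also have "\<dots> = (\<integral>\<^sup>+s. emeasure M {x \<in> space M. s < g x} * indicator {0..<D} s \<partial>lborel)"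
  proof (rule nn_integral_cong)
    fix s
    have "(\<integral>\<^sup>+x. (if s < g x then 1 else 0) \<partial>M) = (\<integral>\<^sup>+x. indicator {x \<in> space M. s < g x} x \<partial>M)"
      by (intro nn_integral_cong) (auto simp: indicator_def)
    also have "\<dots> = emeasure M {x \<in> space M. s < g x}" by simp
    finally show "(\<integral>\<^sup>+x. (if s < g x then 1 else 0) * indicator {0..<D} s \<partial>M) = emeasure M {x \<in> space M. s < g x} * indicator {0..<D} s"
      by (subst nn_integral_multc) simp_all
  qed
  finally show ?thesis .
qed

text \<open>By the layer-cake formula the integral is built from superlevel sets with levels in [0,
  D). Each of them costs at most \<delta>, so the total cost is the oscillation D times
  \<delta>.\<close>

lemma nn_integral_le_of_uniform_bound:
  fixes g :: "'a \<Rightarrow> real"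
  assumes M: "finite_measure M" and N: "finite_measure N" and sets[measurable_cong]: "sets N = sets M"
    and [measurable]: "g \<in> borel_measurable M"
    and g: "\<And>x. x \<in> space M \<Longrightarrow> 0 \<le> g x" "\<And>x. x \<in> space M \<Longrightarrow> g x \<le> D"
    and le: "\<And>A. A \<in> sets M \<Longrightarrow> measure M A \<le> measure N A + \<delta>" and \<delta>: "0 \<le> \<delta>" and D: "0 \<le> D"
  shows "(\<integral>\<^sup>+x. ennreal (g x) \<partial>M) \<le> (\<integral>\<^sup>+x. ennreal (g x) \<partial>N) + ennreal (D * \<delta>)"
proof -
  interpret M: finite_measure M by fact
  interpret N: finite_measure N by fact
  have sp: "space N = space M" using sets by (rule sets_eq_imp_space_eq)
  have [measurable]: "(\<lambda>s. emeasure N {x \<in> space N. s < g x}) \<in> borel_measurable borel"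
    by measurable
  have "(\<integral>\<^sup>+x. ennreal (g x) \<partial>M) = (\<integral>\<^sup>+s. emeasure M {x \<in> space M. s < g x} * indicator {0..<D} s \<partial>lborel)"
    by (rule nn_integral_layer_cake) (use g M.sigma_finite_measure_axioms in auto)
  also have "\<dots> \<le> (\<integral>\<^sup>+s. emeasure N {x \<in> space N. s < g x} * indicator {0..<D} s + ennreal \<delta> * indicator {0..<D} s \<partial>lborel)"
  proof (rule nn_integral_mono)
    fix s
    have "{x \<in> space M. s < g x} \<in> sets M" by measurable
    from le[OF this] have "emeasure M {x \<in> space M. s < g x} \<le> emeasure N {x \<in> space N. s < g x} + ennreal \<delta>"
      using \<delta> by (simp add: M.emeasure_eq_measure N.emeasure_eq_measure sp flip: ennreal_plus)
    then show "emeasure M {x \<in> space M. s < g x} * indicator {0..<D} s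
      \<le> emeasure N {x \<in> space N. s < g x} * indicator {0..<D} s + ennreal \<delta> * indicator {0..<D} s"
      by (auto simp: indicator_def)
  qed
  also have "\<dots> = (\<integral>\<^sup>+s. emeasure N {x \<in> space N. s < g x} * indicator {0..<D} s \<partial>lborel) + (\<integral>\<^sup>+s. ennreal \<delta> * indicator {0..<D} s \<partial>lborel)"
    by (rule nn_integral_add) simp_all
  also have "(\<integral>\<^sup>+s. ennreal \<delta> * indicator {0..<D} s \<partial>lborel) = ennreal (D * \<delta>)"
    using D \<delta> by (simp add: nn_integral_cmult_indicator ennreal_mult[symmetric] mult.commute)
  also have "(\<integral>\<^sup>+s. emeasure N {x \<in> space N. s < g x} * indicator {0..<D} s \<partial>lborel) = (\<integral>\<^sup>+x. ennreal (g x) \<partial>N)"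
    by (rule nn_integral_layer_cake[symmetric]) (use g N.sigma_finite_measure_axioms sp in auto)
  finally show ?thesis .
qed

text \<open>Subtracting the common part L from every K(y, .) leaves a function g of y with values in
  [0, \<rho>]. The constant \<open>measure L A\<close> contributes equally under M and N, so the
  laws after one step differ only through the integrals of g. The remainder is never normalized, so
  \<rho> = 0 is allowed.\<close>

lemma minorization_contraction:
  fixes K :: "'a \<Rightarrow> 'a measure"
  assumes K[measurable]: "K \<in> measurable S (prob_algebra S)"
    and M: "M \<in> space (prob_algebra S)" and N: "N \<in> space (prob_algebra S)"
    and stationary: "\<And>A. A \<in> sets S \<Longrightarrow> (\<integral>\<^sup>+y. emeasure (K y) A \<partial>N) = emeasure N A"
    and L: "finite_measure L" "sets L = sets S" "measure L (space S) = 1 - \<rho>"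
    and minor: "\<And>y A. y \<in> space S \<Longrightarrow> A \<in> sets S \<Longrightarrow> emeasure L A \<le> emeasure (K y) A"
    and \<delta>: "\<And>A. A \<in> sets S \<Longrightarrow> \<bar>measure M A - measure N A\<bar> \<le> \<delta>" and \<rho>: "0 \<le> \<rho>"
    and A: "A \<in> sets S"
  shows "\<bar>measure (M \<bind> K) A - measure N A\<bar> \<le> \<rho> * \<delta>"
proof -
  have MN: "prob_space M" "sets M = sets S" "prob_space N" "sets N = sets S"
    using M N by (auto simp: space_prob_algebra)
  interpret M: prob_space M by fact
  interpret N: prob_space N by fact
  interpret L: finite_measure L by fact
  have sp: "space M = space S" "space N = space S" "space L = space S"
    using MN L(2) by (auto dest: sets_eq_imp_space_eq)
  have Kp: "prob_space (K y)" "sets (K y) = sets S" "space (K y) = space S" if "y \<in> space S" for y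
    using measurable_space[OF K that] by (auto simp: space_prob_algebra dest: sets_eq_imp_space_eq)
  have Ksub: "K \<in> measurable S (subprob_algebra S)"
    using K by (rule measurable_prob_algebraD)
  define g where "g = (\<lambda>y. measure (K y) A - measure L A)"
  have gm: "g \<in> borel_measurable S"
    unfolding g_def using measurable_compose[OF Ksub measurable_measure_subprob_algebra[OF A]] by simp
  have g: "0 \<le> g y" "g y \<le> \<rho>" if y: "y \<in> space S" for y
  proof -
    interpret Ky: prob_space "K y" using Kp y by blast
    have le: "measure L B \<le> measure (K y) B" if "B \<in> sets S" for B
      using minor[OF y that] by (simp add: L.emeasure_eq_measure Ky.emeasure_eq_measure)
    show "0 \<le> g y" using le[OF A] by (simp add: g_def)
    \<comment> \<open>The upper bound on g is the minorization applied to the complement of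
      A.\<close>
    have "measure L (space S - A) \<le> measure (K y) (space S - A)" using A by (intro le) auto
    moreover have "measure L (space S - A) = measure L (space S) - measure L A"
      using L.finite_measure_compl[of A] A L(2) sp by simp
    moreover have "measure (K y) (space S - A) = 1 - measure (K y) A"
      using Ky.prob_compl[of A] A Kp[OF y] by simp
    ultimately show "g y \<le> \<rho>" using L(3) by (simp add: g_def)
  qed
  have split: "(\<integral>\<^sup>+y. emeasure (K y) A \<partial>P) = (\<integral>\<^sup>+y. ennreal (g y) \<partial>P) + ennreal (measure L A)"
    if "prob_space P" "sets P = sets S" for P
  proof -
    interpret P: prob_space P by fact
    have spP: "space P = space S" using that(2) by (rule sets_eq_imp_space_eq)
    have [measurable]: "g \<in> borel_measurable P" using gm that(2) by (simp cong: measurable_cong_sets)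
    have "(\<integral>\<^sup>+y. emeasure (K y) A \<partial>P) = (\<integral>\<^sup>+y. ennreal (g y) + ennreal (measure L A) \<partial>P)"
    proof (rule nn_integral_cong)
      fix y assume "y \<in> space P"
      then have y: "y \<in> space S" by (simp add: spP)
      interpret Ky: prob_space "K y" using Kp y by blast
      show "emeasure (K y) A = ennreal (g y) + ennreal (measure L A)"
        using g(1)[OF y] by (simp add: Ky.emeasure_eq_measure g_def flip: ennreal_plus)
    qed
    also have "\<dots> = (\<integral>\<^sup>+y. ennreal (g y) \<partial>P) + ennreal (measure L A)"
      by (subst nn_integral_add) (simp_all add: P.emeasure_space_1)
    finally show ?thesis .
  qed
  have MK: "prob_space (M \<bind> K)" "sets (M \<bind> K) = sets S"
    using prob_space_bind'[OF M K] sets_bind'[OF M K] by auto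
  interpret MK: prob_space "M \<bind> K" by fact
  have \<delta>0: "0 \<le> \<delta>" using \<delta>[OF A] by linarith
  have bind: "emeasure (M \<bind> K) A = (\<integral>\<^sup>+y. ennreal (g y) \<partial>M) + ennreal (measure L A)"
    using emeasure_bind_prob_algebra[OF M K A] split[OF MN(1,2)] by simp
  have stat: "emeasure N A = (\<integral>\<^sup>+y. ennreal (g y) \<partial>N) + ennreal (measure L A)"
    using stationary[OF A] split[OF MN(3,4)] by simp
  have "(\<integral>\<^sup>+y. ennreal (g y) \<partial>M) \<le> (\<integral>\<^sup>+y. ennreal (g y) \<partial>N) + ennreal (\<rho> * \<delta>)"
    using MN gm g sp \<delta>0 \<rho> \<delta>
    by (intro nn_integral_le_of_uniform_bound M.finite_measure_axioms N.finite_measure_axioms)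
      (auto cong: measurable_cong_sets simp: abs_le_iff algebra_simps)
  then have "emeasure (M \<bind> K) A \<le> emeasure N A + ennreal (\<rho> * \<delta>)"
    unfolding bind stat by (simp add: add.assoc add.commute[of "ennreal (measure L A)"] add_right_mono flip: add.assoc)
  moreover
  have "(\<integral>\<^sup>+y. ennreal (g y) \<partial>N) \<le> (\<integral>\<^sup>+y. ennreal (g y) \<partial>M) + ennreal (\<rho> * \<delta>)"
    using MN gm g sp \<delta>0 \<rho> \<delta>
    by (intro nn_integral_le_of_uniform_bound M.finite_measure_axioms N.finite_measure_axioms)
      (auto cong: measurable_cong_sets simp: abs_le_iff algebra_simps)
  then have "emeasure N A \<le> emeasure (M \<bind> K) A + ennreal (\<rho> * \<delta>)"
    unfolding bind stat by (simp add: add.assoc add.commute[of "ennreal (measure L A)"] add_right_mono flip: add.assoc)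
  ultimately have "ennreal (measure (M \<bind> K) A) \<le> ennreal (measure N A + \<rho> * \<delta>)"
    "ennreal (measure N A) \<le> ennreal (measure (M \<bind> K) A + \<rho> * \<delta>)"
    using \<rho> \<delta>0 by (simp_all add: MK.emeasure_eq_measure N.emeasure_eq_measure)
  then have "measure (M \<bind> K) A \<le> measure N A + \<rho> * \<delta>" "measure N A \<le> measure (M \<bind> K) A + \<rho> * \<delta>"
    using \<rho> \<delta>0 by (simp_all only: ennreal_le_iff measure_nonneg add_nonneg_nonneg mult_nonneg_nonneg)
  then show ?thesis by (simp add: abs_le_iff)
qed

section \<open>The slice sampling kernel\<close>

text \<open>\<open>Hker\<close> and \<open>Hn\<close> are built by \<open>measure_of\<close> from
  bare set functions, whose values count only once they are known to form a measure. A genuine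
  measure with the same values settles this.\<close>

lemma measure_of_eq_measure:
  assumes "sets M = sets S" and "\<And>A. A \<in> sets S \<Longrightarrow> \<mu> A = emeasure M A"
  shows "measure_of (space S) (sets S) \<mu> = M"
proof -
  have "measure_of (space S) (sets S) \<mu> = measure_of (space M) (sets M) (emeasure M)"
    unfolding assms(1) sets_eq_imp_space_eq[OF assms(1)]
    by (rule measure_of_eq) (use assms(2) sets.space_closed in \<open>auto simp: sets.sigma_sets_eq\<close>)
  then show ?thesis by (simp add: measure_of_of_measure)
qed

lemma ennreal_inverse_antimono:
  fixes a b :: ennreal
  shows "a \<le> b \<Longrightarrow> inverse b \<le> inverse a"
  including ennreal.lifting by transfer (rule ereal_inverse_antimono)

lemma space_sph_space: "space sph_space = sphere 0 1"
  by (simp add: space_restrict_space)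

context geodesic_slice
begin

text \<open>Includes the uniform law, so that one density describes \<open>Hker\<close> at every
  unit vector.\<close>

definition dens :: "'a \<Rightarrow> 'a \<Rightarrow> ennreal" where
  "dens x y = (if Hwd B p x then slice_dens x y else ennreal (1 / omega TYPE('a)))"

lemma dens_measurable[measurable]: "dens x \<in> borel_measurable borel"
  unfolding dens_def by (cases "Hwd B p x") simp_all

lemma Hker_eq_density:
  fixes x :: 'a
  assumes x: "norm x = 1"
  shows "Hker B p x = density surf (dens x)"
proof (cases "Hwd B p x")
  case True
  have "measure_of (space sph_space) (sets sph_space) (Hval B p x) = density surf (dens x)"
  proof (rule measure_of_eq_measure)
    fix A :: "'a set" assume A: "A \<in> sets sph_space"
    have "emeasure (density surf (dens x)) A = (\<integral>\<^sup>+y. dens x y * indicator A y \<partial>surf)"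
      by (rule emeasure_density) (use A measurable_surf_of_borel[OF dens_measurable] in simp_all)
    then show "Hval B p x A = emeasure (density surf (dens x)) A"
      using True Hval_eq[OF x sets_sph_space_imp_borel[OF A]] by (simp add: dens_def)
  qed simp
  then show ?thesis using True by (simp add: Hker_def space_sph_space)
next
  case False
  show ?thesis
  proof (rule measure_eqI)
    show "sets (Hker B p x) = sets (density surf (dens x))" using False by (simp add: Hker_def)
    fix A assume "A \<in> sets (Hker B p x)"
    then have A: "A \<in> sets (surf :: 'a measure)" using False by (simp add: Hker_def)
    have "emeasure (density surf (dens x)) A = (\<integral>\<^sup>+y. dens x y * indicator A y \<partial>surf)"
      by (rule emeasure_density) (use A measurable_surf_of_borel[OF dens_measurable] in simp_all)
    also have "\<dots> = ennreal (1 / omega TYPE('a)) * emeasure surf A"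
      using False A by (simp add: dens_def nn_integral_cmult_indicator)
    finally show "emeasure (Hker B p x) A = emeasure (density surf (dens x)) A"
      using False by (simp add: Hker_def)
  qed
qed

lemma emeasure_Hker:
  fixes x :: 'a
  assumes "norm x = 1" and "A \<in> sets sph_space"
  shows "emeasure (Hker B p x) A = (\<integral>\<^sup>+y. dens x y * indicator A y \<partial>surf)"
  unfolding Hker_eq_density[OF assms(1)]
  by (rule emeasure_density) (use assms(2) measurable_surf_of_borel[OF dens_measurable] in simp_all)

lemma dens_integral:
  fixes x :: 'a
  assumes "norm x = 1"
  shows "(\<integral>\<^sup>+y. dens x y \<partial>surf) = 1"
proof (cases "Hwd B p x")
  case True
  then show ?thesis using slice_dens_integral[OF assms] by (simp add: dens_def)
next
  case False
  then show ?thesis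
    using omega_pos[of "TYPE('a)"]
    by (simp add: dens_def emeasure_surf_sphere_omega[of "TYPE('a)"] ennreal_mult[symmetric])
qed

lemma Hker_measurable: "Hker B p \<in> measurable sph_space (prob_algebra sph_space)"
proof (rule measurable_prob_algebraI)
  show prob: "prob_space (Hker B p x)" if "x \<in> space sph_space" for x
  proof (rule prob_spaceI)
    from that have x: "norm x = 1" by (simp add: space_sph_space)
    have "emeasure (Hker B p x) (sphere 0 1) = (\<integral>\<^sup>+y. dens x y * indicator (sphere 0 1) y \<partial>surf)"
      by (rule emeasure_Hker[OF x]) (use sets.top[of sph_space] in \<open>simp add: space_sph_space\<close>)
    also have "\<dots> = (\<integral>\<^sup>+y. dens x y \<partial>surf)"
      by (intro nn_integral_cong) simp
    finally show "emeasure (Hker B p x) (space (Hker B p x)) = 1"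
      using dens_integral[OF x] by (simp add: Hker_eq_density[OF x])
  qed
  have sets: "sets (Hker B p x) = sets sph_space" if "x \<in> space sph_space" for x
    using that by (simp add: space_sph_space Hker_eq_density)
  have "(\<lambda>x. emeasure (Hker B p x) A) \<in> borel_measurable sph_space" if A: "A \<in> sets sph_space" for A
  proof -
    have [measurable]: "A \<in> sets borel" using A by (rule sets_sph_space_imp_borel)
    have 1: "(\<lambda>x. \<integral>\<^sup>+y. slice_dens x y * indicator A y \<partial>surf) \<in> borel_measurable sph_space"
      by (rule measurable_restrict_space1) measurable
    have "(\<lambda>x. if Hwd B p x then \<integral>\<^sup>+y. slice_dens x y * indicator A y \<partial>surf
        else \<integral>\<^sup>+y. ennreal (1 / omega TYPE('a)) * indicator A y \<partial>(surf :: 'a measure)) \<in> borel_measurable sph_space"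
      by (rule measurable_If[OF 1 _ Hwd_measurable[unfolded pred_def]]) simp
    also have "?this \<longleftrightarrow> (\<lambda>x. emeasure (Hker B p x) A) \<in> borel_measurable sph_space"
      by (rule measurable_cong) (simp add: space_sph_space emeasure_Hker A dens_def)
    finally show ?thesis .
  qed
  then show "Hker B p \<in> measurable sph_space (subprob_algebra sph_space)"
    by (intro measurable_subprob_algebra)
       (auto simp: sets intro!: prob_space_imp_subprob_space prob)
qed

section \<open>Iterates of the kernel\<close>

lemma Hn_prob:
  fixes x :: 'a
  assumes x: "norm x = 1"
  shows "Hn B p n x \<in> space (prob_algebra sph_space)"
    and "Hn B p (Suc n) x = Hn B p n x \<bind> Hker B p"
proof -
  have step: "Hn B p (Suc n) x = Hn B p n x \<bind> Hker B p" if P: "Hn B p n x \<in> space (prob_algebra sph_space)" for n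
  proof -
    have "measure_of (space sph_space) (sets sph_space) (\<lambda>A. \<integral>\<^sup>+y. emeasure (Hker B p y) A \<partial>Hn B p n x)
        = Hn B p n x \<bind> Hker B p"
      by (rule measure_of_eq_measure)
         (simp_all only: sets_bind'[OF P Hker_measurable] emeasure_bind_prob_algebra[OF P Hker_measurable])
    then show ?thesis by (simp only: Hn.simps space_sph_space)
  qed
  have P: "Hn B p n x \<in> space (prob_algebra sph_space)" for n
  proof (induction n)
    case 0
    show ?case using x by (simp add: space_prob_algebra prob_space_return space_sph_space)
  next
    case (Suc n)
    show ?case
      unfolding step[OF Suc] space_prob_algebra
      using prob_space_bind'[OF Suc Hker_measurable] sets_bind'[OF Suc Hker_measurable] by simp
  qed
  show "Hn B p n x \<in> space (prob_algebra sph_space)" by (rule P)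
  show "Hn B p (Suc n) x = Hn B p n x \<bind> Hker B p" by (rule step[OF P])
qed

section \<open>Uniform lower bound and stationarity\<close>

lemma sym_dens_ge:
  assumes "norm x = 1" "norm y = 1"
  shows "ennreal (min (p x) (p y) / (2 * pi)) \<le> sym_dens x y"
proof -
  let ?s = "gsin x y ^ (DIM('b) - 1)"
  have "inverse (ennreal (2 * pi)) * 1 \<le> inverse (len x (gdir x y) t) * inverse (ennreal ?s)" for t
  proof (rule mult_mono)
    show "inverse (ennreal (2 * pi)) \<le> inverse (len x (gdir x y) t)"
      using len_le by (rule ennreal_inverse_antimono)
    have "ennreal ?s \<le> 1" using gsin_bounds[OF assms] by (simp add: power_le_one)
    then have "inverse 1 \<le> inverse (ennreal ?s)" by (rule ennreal_inverse_antimono)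
    then show "1 \<le> inverse (ennreal ?s)" by simp
  qed simp_all
  then have *: "inverse (ennreal (2 * pi)) \<le> inverse (len x (gdir x y) t) * inverse (ennreal ?s)" for t
    by simp
  have "ennreal (min (p x) (p y) / (2 * pi)) = inverse (ennreal (2 * pi)) * ennreal (min (p x) (p y))"
    using p_pos[of x] p_pos[of y] by (simp add: inverse_ennreal ennreal_mult[symmetric] field_simps)
  also have "\<dots> = (\<integral>\<^sup>+t. inverse (ennreal (2 * pi)) * indicator {0<..<min (p x) (p y)} t \<partial>lborel)"
    using p_pos[of x] p_pos[of y] by (subst nn_integral_cmult_indicator) simp_all
  also have "\<dots> \<le> sym_dens x y"
    unfolding sym_dens_def
  proof (rule nn_integral_mono)
    fix t
    show "inverse (ennreal (2 * pi)) * indicator {0<..<min (p x) (p y)} t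
      \<le> indicator {0<..} t * (if t < p x then 1 else 0) * (if t < p y then 1 else 0)
          * inverse (len x (gdir x y) t) * inverse (ennreal ?s)"
      using *[of t] by (auto simp: indicator_def)
  qed
  finally show ?thesis .
qed

text \<open>The ratio min (p x) (p y) / p x is 1 or p y / p x, and either is at least i / M. At
  points carrying the uniform law, \<open>omega_le\<close> gives the same bound.\<close>

lemma dens_ge:
  assumes x: "norm x = 1" and y: "norm y = 1"
    and i: "0 < i" "i \<le> p y" "i \<le> M" and M: "p x \<le> M"
  shows "ennreal (i / M / (2 * pi * omega B)) \<le> dens x y"
proof (cases "Hwd B p x")
  case True
  have w: "omega B > 0" by (rule omega_pos)
  have px: "p x > 0" by (rule p_pos)
  have Mp: "M > 0" using px M by simp
  have "i / M \<le> min (p x) (p y) / p x"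
  proof (cases "p x \<le> p y")
    case True
    then show ?thesis using px Mp i by simp
  next
    case False
    have "i / M \<le> p y / p x" using i M px Mp by (intro frac_le) auto
    then show ?thesis using False by simp
  qed
  then have "i / M / (2 * pi * omega B) \<le> min (p x) (p y) / p x / (2 * pi * omega B)"
    using w by (intro divide_right_mono) auto
  \<comment> \<open>The factor 2 from the double covering by great circles is given up here, in
    accordance with the 2 pi in the definition of \<rho>.\<close>
  also have "\<dots> \<le> 2 / (p x * omega B) * (min (p x) (p y) / (2 * pi))"
  proof -
    let ?a = "min (p x) (p y) / p x / (2 * pi * omega B)"
    have "0 \<le> ?a" using w px p_pos[of y] by simp
    moreover have "2 / (p x * omega B) * (min (p x) (p y) / (2 * pi)) = 2 * ?a"
      by (simp add: field_simps)
    ultimately show ?thesis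
      using mult_right_mono[of 1 2 ?a] by (simp only: mult_1)
  qed
  finally have "ennreal (i / M / (2 * pi * omega B)) \<le> ennreal (2 / (p x * omega B) * (min (p x) (p y) / (2 * pi)))"
    by (rule ennreal_leI)
  also have "\<dots> = ennreal (2 / (p x * omega B)) * ennreal (min (p x) (p y) / (2 * pi))"
    using w px p_pos[of y] by (intro ennreal_mult) auto
  also have "\<dots> \<le> ennreal (2 / (p x * omega B)) * sym_dens x y"
    by (intro mult_left_mono sym_dens_ge x y) simp
  finally show ?thesis using True by (simp add: dens_def slice_dens_def)
next
  case False
  have w: "omega B > 0" "omega TYPE('a) > 0" by (rule omega_pos)+
  have "i / M / (2 * pi * omega B) \<le> 1 / (2 * pi * omega B)"
    using i w by (intro divide_right_mono) (auto simp: divide_le_eq)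
  also have "\<dots> \<le> 1 / omega TYPE('a)"
    using omega_le w by (intro divide_left_mono) auto
  finally show ?thesis using False by (simp add: dens_def ennreal_leI)
qed

text \<open>Multiplying by p x removes the only asymmetric factor of the density. Almost sure
  well-definedness enters twice: at x to replace H by its slice density, since the uniform law need
  not be reversible, and at y to know that the exchanged density has mass 1.\<close>

lemma reversible_stationary:
  assumes A: "A \<in> sets sph_space"
  shows "(\<integral>\<^sup>+x. ennreal (p x) * emeasure (Hker B p x) A \<partial>surf) = (\<integral>\<^sup>+y. ennreal (p y) * indicator A y \<partial>surf)"
proof -
  have [measurable]: "A \<in> sets borel" using A by (rule sets_sph_space_imp_borel)
  define c where "c = ennreal (2 / omega B)"
  have pk: "ennreal (p x) * slice_dens x y = c * sym_dens x y" for x y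
    using p_pos[of x] omega_pos[of B]
    by (simp add: slice_dens_def c_def mult.assoc[symmetric] ennreal_mult[symmetric])
  have "(\<integral>\<^sup>+x. ennreal (p x) * emeasure (Hker B p x) A \<partial>surf) = (\<integral>\<^sup>+x. \<integral>\<^sup>+y. c * sym_dens x y * indicator A y \<partial>surf \<partial>surf)"
  proof (rule nn_integral_cong_AE)
    show "AE x in surf. ennreal (p x) * emeasure (Hker B p x) A = (\<integral>\<^sup>+y. c * sym_dens x y * indicator A y \<partial>surf)"
      using AE_Hwd AE_space
    proof eventually_elim
      case (elim x)
      then have "ennreal (p x) * emeasure (Hker B p x) A = ennreal (p x) * (\<integral>\<^sup>+y. slice_dens x y * indicator A y \<partial>surf)"
        by (simp add: emeasure_Hker[OF _ A] dens_def)
      also have "\<dots> = (\<integral>\<^sup>+y. ennreal (p x) * (slice_dens x y * indicator A y) \<partial>surf)"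
        by (rule nn_integral_cmult[symmetric]) (rule measurable_surf_of_borel, simp)
      finally show ?case by (simp add: mult.assoc[symmetric] pk)
    qed
  qed
  also have "\<dots> = (\<integral>\<^sup>+y. \<integral>\<^sup>+x. c * sym_dens x y * indicator A y \<partial>surf \<partial>surf)"
    by (rule Fubini_surf_surf[symmetric]) measurable
  also have "\<dots> = (\<integral>\<^sup>+y. ennreal (p y) * indicator A y \<partial>surf)"
  proof (rule nn_integral_cong_AE)
    show "AE y in surf. (\<integral>\<^sup>+x. c * sym_dens x y * indicator A y \<partial>surf) = ennreal (p y) * indicator A y"
      using AE_Hwd AE_space
    proof eventually_elim
      case (elim y)
      then have y: "norm y = 1" by simp
      have "(\<integral>\<^sup>+x. c * sym_dens x y * indicator A y \<partial>surf) = (\<integral>\<^sup>+x. (ennreal (p y) * indicator A y) * slice_dens y x \<partial>surf)"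
      proof (rule nn_integral_cong_AE)
        show "AE x in surf. c * sym_dens x y * indicator A y = ennreal (p y) * indicator A y * slice_dens y x"
          using AE_gsin_nonzero[OF y] AE_space
        proof eventually_elim
          case (elim x)
          then have "sym_dens y x = sym_dens x y" by (intro sym_dens_commute[OF y]) simp_all
          then have eq: "c * sym_dens x y = ennreal (p y) * slice_dens y x" by (simp add: pk)
          show ?case unfolding eq by (simp add: mult_ac)
        qed
      qed
      also have "\<dots> = ennreal (p y) * indicator A y * (\<integral>\<^sup>+x. slice_dens y x \<partial>surf)"
        by (rule nn_integral_cmult) (rule measurable_surf_of_borel, simp)
      finally show ?case using slice_dens_integral[OF y elim(1)] by simp
    qed
  qed
  finally show ?thesis .
qed

lemma target_prob:
  assumes int: "integrable surf p" and pos: "0 < integral\<^sup>L surf p"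
  shows "target p \<in> space (prob_algebra sph_space)"
    and "\<And>A. A \<in> sets sph_space \<Longrightarrow> (\<integral>\<^sup>+y. emeasure (Hker B p y) A \<partial>target p) = emeasure (target p) A"
proof -
  define Z where "Z = integral\<^sup>L surf p"
  have Z: "Z > 0" using pos by (simp add: Z_def)
  have pm: "(\<lambda>x. ennreal (p x / Z)) \<in> borel_measurable surf"
    by (rule measurable_surf_of_borel) simp
  have t: "target p = density surf (\<lambda>x. ennreal (p x / Z))" by (simp add: target_def Z_def)
  have pZ: "ennreal (p x / Z) = ennreal (1 / Z) * ennreal (p x)" for x
    using Z p_pos[of x] by (simp add: ennreal_mult[symmetric])
  have pnn: "(\<integral>\<^sup>+x. ennreal (p x) \<partial>surf) = ennreal Z"
    unfolding Z_def using int p_pos by (intro nn_integral_eq_integral) (auto intro: less_imp_le)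
  have pms: "(\<lambda>x. ennreal (p x)) \<in> borel_measurable surf"
    by (rule measurable_surf_of_borel) simp
  have "prob_space (target p)"
  proof (rule prob_spaceI)
    have "emeasure (target p) (sphere 0 1) = (\<integral>\<^sup>+x. ennreal (p x / Z) * indicator (sphere 0 1) x \<partial>surf)"
      unfolding t by (rule emeasure_density[OF pm]) (use sets.top[of "surf :: 'a measure"] in simp)
    also have "\<dots> = (\<integral>\<^sup>+x. ennreal (1 / Z) * ennreal (p x) \<partial>surf)"
      by (intro nn_integral_cong) (simp add: pZ)
    also have "\<dots> = ennreal (1 / Z) * ennreal Z"
      by (subst nn_integral_cmult[OF pms]) (simp add: pnn)
    also have "\<dots> = 1" using Z by (simp add: ennreal_mult[symmetric])
    finally show "emeasure (target p) (space (target p)) = 1" by (simp add: t)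
  qed
  then show "target p \<in> space (prob_algebra sph_space)"
    by (simp add: space_prob_algebra t)
  fix A :: "'a set" assume A: "A \<in> sets sph_space"
  have Km: "(\<lambda>y. emeasure (Hker B p y) A) \<in> borel_measurable surf"
    using measurable_compose[OF measurable_prob_algebraD[OF Hker_measurable] measurable_emeasure_subprob_algebra[OF A]]
    by (simp add: measurable_cong_sets[OF sets_surf refl])
  have Am: "indicator A \<in> borel_measurable (surf :: 'a measure)"
    by (rule borel_measurable_indicator) (use A in simp)
  have "(\<integral>\<^sup>+y. emeasure (Hker B p y) A \<partial>target p) = (\<integral>\<^sup>+y. ennreal (1 / Z) * (ennreal (p y) * emeasure (Hker B p y) A) \<partial>surf)"
    unfolding t by (subst nn_integral_density[OF pm Km]) (simp add: pZ mult.assoc)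
  also have "\<dots> = ennreal (1 / Z) * (\<integral>\<^sup>+y. ennreal (p y) * emeasure (Hker B p y) A \<partial>surf)"
    by (rule nn_integral_cmult[OF borel_measurable_times_ennreal[OF pms Km]])
  also have "\<dots> = ennreal (1 / Z) * (\<integral>\<^sup>+y. ennreal (p y) * indicator A y \<partial>surf)"
    by (simp only: reversible_stationary[OF A])
  also have "\<dots> = (\<integral>\<^sup>+y. ennreal (1 / Z) * (ennreal (p y) * indicator A y) \<partial>surf)"
    by (rule nn_integral_cmult[OF borel_measurable_times_ennreal[OF pms Am], symmetric])
  also have "\<dots> = emeasure (target p) A"
    unfolding t by (subst emeasure_density[OF pm]) (use A in \<open>simp_all add: pZ mult.assoc\<close>)
  finally show "(\<integral>\<^sup>+y. emeasure (Hker B p y) A \<partial>target p) = emeasure (target p) A" .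
qed

text \<open>The induction carries all sets A at once, because one contraction step needs the
  previous bound on every superlevel set of the residual function.\<close>

lemma Hn_convergence:
  fixes x :: 'a
  assumes int: "integrable surf p" and pos: "0 < integral\<^sup>L surf p"
    and C: "C \<in> sets sph_space"
    and i: "0 < i" "i \<le> M" "\<And>y. y \<in> C \<Longrightarrow> i \<le> p y" and M: "\<And>y. norm y = 1 \<Longrightarrow> p y \<le> M"
    and \<rho>: "\<rho> = 1 - i / M / (2 * pi) * (measure surf C / omega B)" "0 \<le> \<rho>"
    and x: "norm x = 1" and A: "A \<in> sets sph_space"
  shows "\<bar>measure (Hn B p n x) A - measure (target p) A\<bar> \<le> \<rho> ^ n"
  using A
proof (induction n arbitrary: A)
  case 0
  have "prob_space (Hn B p 0 x)" "prob_space (target p)"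
    using Hn_prob(1)[OF x, of 0] target_prob(1)[OF int pos] by (simp_all only: space_prob_algebra mem_Collect_eq)
  then have "measure (Hn B p 0 x) A \<le> 1" "measure (target p) A \<le> 1"
    by (simp_all only: prob_space.prob_le_1)
  moreover have "0 \<le> measure (Hn B p 0 x) A" "0 \<le> measure (target p) A" by simp_all
  ultimately show ?case unfolding power_0 abs_le_iff by linarith
next
  case (Suc n)
  \<comment> \<open>This is the lower bound of \<open>dens_ge\<close>. The minorizing measure is
    \<open>e\<close> times the surface measure on \<open>C\<close>, and its mass is exactly 1 -
    \<rho>.\<close>
  define e where "e = i / M / (2 * pi * omega B)"
  have e: "0 \<le> e" using i omega_pos[of B] by (simp add: e_def)
  let ?L = "scale_measure (ennreal e) (density surf (indicator C))"
  have Cm: "indicator C \<in> borel_measurable (surf :: 'a measure)"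
    by (rule borel_measurable_indicator) (use C in simp)
  have L: "emeasure ?L D = ennreal e * emeasure surf (C \<inter> D)" if "D \<in> sets sph_space" for D
  proof -
    have "emeasure (density surf (indicator C)) D = (\<integral>\<^sup>+y. indicator C y * indicator D y \<partial>surf)"
      by (rule emeasure_density[OF Cm]) (use that in simp)
    also have "\<dots> = (\<integral>\<^sup>+y. indicator (C \<inter> D) y \<partial>surf)"
      by (simp add: indicator_inter_arith)
    also have "\<dots> = emeasure surf (C \<inter> D)"
      by (rule nn_integral_indicator) (use that C in auto)
    finally show ?thesis by simp
  qed
  have top: "sphere 0 1 \<in> sets (sph_space :: 'a measure)"
    using sets.top[of "sph_space :: 'a measure"] by (simp add: space_sph_space)
  have CS: "C \<inter> sphere 0 1 = C" using sets.sets_into_space[OF C] by (auto simp: space_sph_space)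
  show ?case
    unfolding Hn_prob(2)[OF x] power_Suc
  proof (rule minorization_contraction[OF Hker_measurable Hn_prob(1)[OF x] target_prob(1)[OF int pos]
      target_prob(2)[OF int pos] _ _ _ _ Suc.IH \<rho>(2) Suc.prems])
    have Ls: "emeasure ?L (space sph_space) = ennreal (e * measure surf C)"
      unfolding space_sph_space L[OF top] CS using e by (simp add: surf.emeasure_eq_measure ennreal_mult)
    then show "finite_measure ?L"
      by (intro finite_measureI) (simp add: space_sph_space space_scale_measure)
    have "measure ?L (space sph_space) = e * measure surf C"
      by (subst measure_def, subst Ls, rule enn2real_ennreal) (use e in simp)
    then show "measure ?L (space sph_space) = 1 - \<rho>"
      by (simp add: e_def \<rho>(1))
    show "sets ?L = sets sph_space"
      by (simp only: sets_scale_measure sets_density sets_surf)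
    fix y :: 'a and D :: "'a set" assume "y \<in> space sph_space" and D: "D \<in> sets sph_space"
    then have y: "norm y = 1" by (simp add: space_sph_space)
    have CD: "C \<inter> D \<in> sets (surf :: 'a measure)" using C D by auto
    have "emeasure ?L D = (\<integral>\<^sup>+z. ennreal e * indicator (C \<inter> D) z \<partial>surf)"
      by (simp only: L[OF D] nn_integral_cmult_indicator[OF CD])
    also have "\<dots> \<le> (\<integral>\<^sup>+z. dens y z * indicator D z \<partial>surf)"
    proof (rule nn_integral_mono)
      fix z assume "z \<in> space (surf :: 'a measure)"
      then have z: "norm z = 1" by simp
      show "ennreal e * indicator (C \<inter> D) z \<le> dens y z * indicator D z"
        using dens_ge[OF y z i(1) _ i(2) M[OF y]] i(3) by (auto simp: indicator_def e_def)
    qed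
    also have "\<dots> = emeasure (Hker B p y) D" by (rule emeasure_Hker[OF y D, symmetric])
    finally show "emeasure ?L D \<le> emeasure (Hker B p y) D" .
  qed
qed

end

text \<open>The values of \<open>p\<close> off the sphere are irrelevant, so \<open>p\<close> may be taken Borel and positive
  on the whole space.\<close>

lemma Hker_cong:
  assumes "\<And>y. y \<in> sphere 0 1 \<Longrightarrow> p y = q y" and x: "norm x = 1"
  shows "Hker B p x = Hker B q x"
proof -
  have g: "geod x v \<theta> \<in> sphere 0 1" if "v \<in> subsph x" for v \<theta>
  proof -
    have "(norm (geod x v \<theta>))\<^sup>2 = (cos \<theta>)\<^sup>2 * (x \<bullet> x) + (sin \<theta>)\<^sup>2 * (v \<bullet> v)"
      using that unfolding geod_def power2_norm_eq_inner
      by (simp add: subsph_def inner_simps inner_commute[of x v] power2_eq_square)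
    then have "(norm (geod x v \<theta>))\<^sup>2 = 1"
      using that x by (simp add: subsph_def dot_square_norm)
    then show ?thesis by (simp add: abs_square_eq_1)
  qed
  have l: "lvl p x v t = lvl q x v t" if "v \<in> subsph x" for v t
    using assms(1)[OF g[OF that]] by (simp add: lvl_def)
  have px: "p x = q x" using assms by simp
  have "Hval B p x = Hval B q x"
  proof
    fix A
    show "Hval B p x A = Hval B q x A"
      unfolding Hval_def px
      by (intro arg_cong2[where f = "(*)"] nn_integral_cong refl) (simp_all add: l)
  qed
  moreover have "Hwd B p x = Hwd B q x"
    unfolding Hwd_def px by (intro AE_cong imp_cong refl) (simp add: l)
  ultimately show ?thesis by (simp add: Hker_def)
qed

lemma Hn_cong:
  assumes "\<And>y. y \<in> sphere 0 1 \<Longrightarrow> p y = q y" and x: "norm x = 1"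
  shows "Hn B p n x = Hn B q n x"
proof (induction n)
  case (Suc n)
  \<comment> \<open>Both \<open>return\<close> and \<open>measure_of\<close> fix the underlying
    space whatever values the set function takes, so no measurability of the kernel enters.\<close>
  have sp: "space (Hn B q n x) = sphere 0 1"
    by (cases n) (simp_all add: space_sph_space space_measure_of_conv)
  have "Hker B p y = Hker B q y" if "y \<in> space (Hn B q n x)" for y
    by (rule Hker_cong[OF assms(1)]) (use that sp in simp_all)
  then have "(\<integral>\<^sup>+y. emeasure (Hker B p y) A \<partial>Hn B q n x) = (\<integral>\<^sup>+y. emeasure (Hker B q y) A \<partial>Hn B q n x)" for A
    by (intro nn_integral_cong) simp
  then show ?case using Suc by simp
qed simp

theorem mainTheorem1:
  fixes p :: "'a::euclidean_space \<Rightarrow> real" and C :: "'a set"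
  assumes "DIM('a) \<ge> 3" and "DIM('b::euclidean_space) + 1 = DIM('a)"
    and "p \<in> borel_measurable sph_space"
    and "\<forall>x\<in>sphere 0 1. 0 < p x"
    and "integrable surf p" and "0 < integral\<^sup>L surf p"
    and "C \<in> sets surf" and "0 < measure surf C"
    and "0 < Inf (p ` C)" and "bdd_above (p ` sphere 0 1)"
  shows "let \<beta> = Inf (p ` C) / Sup (p ` sphere 0 1);
             \<rho> = 1 - \<beta> / (2 * pi) * (measure surf C / omega TYPE('b))
         in \<beta> \<in> {0<..1} \<and> \<rho> \<in> {0<..<1} \<and>
            (\<forall>n. (SUP x \<in> sphere 0 1. tv (Hn TYPE('b) p n x) (target p)) \<le> \<rho> ^ n)"
proof -
  \<comment> \<open>The given p is controlled only on the sphere. The value 1 elsewhere makes q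
    positive and Borel everywhere, as the locale demands.\<close>
  define q where "q y = (if y \<in> sphere 0 1 then p y else 1)" for y
  have pq: "q y = p y" if "y \<in> sphere 0 1" for y using that by (simp add: q_def)
  have qm: "q \<in> borel_measurable borel"
    unfolding q_def by (rule measurable_If_restrict_space_iff[THEN iffD2])
      (simp, rule conjI, simp only: Collect_mem_eq assms(3), simp)
  interpret geodesic_slice q "TYPE('b)"
  proof
    show "q \<in> borel_measurable borel" by (rule qm)
    show "0 < q x" for x using assms(4) by (simp add: q_def)
    show "DIM('b) + 1 = DIM('a)" "2 \<le> DIM('b)" using assms(1,2) by simp_all
  qed
  have int_q: "integrable surf q = integrable surf p" "integral\<^sup>L surf q = integral\<^sup>L surf p"
    by (rule Bochner_Integration.integrable_cong[OF refl pq] Bochner_Integration.integral_cong[OF refl pq]; simp)+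
  have [measurable]: "p \<in> borel_measurable surf" "q \<in> borel_measurable surf"
    using assms(3) measurable_cong_sets[OF sets_surf refl] measurable_surf_of_borel[OF qm] by blast+
  have tq: "target p = target q"
    unfolding target_def int_q by (intro density_cong) (auto simp: pq)
  define i where "i = Inf (p ` C)"
  define M where "M = Sup (p ` sphere 0 1)"
  define \<rho> where "\<rho> = 1 - i / M / (2 * pi) * (measure surf C / omega TYPE('b))"
  have C: "C \<subseteq> sphere 0 1" using sets.sets_into_space[OF assms(7)] by simp
  have "C \<noteq> {}" using assms(8) by auto
  then obtain c where c: "c \<in> C" by blast
  have ip: "i \<le> p y" if "y \<in> C" for y
    \<comment> \<open>Positivity of p bounds the image of \<open>C\<close> below by 0; otherwise the
      real infimum would carry no information.\<close>
    unfolding i_def using that C assms(4) by (intro cINF_lower bdd_belowI[of _ 0]) (auto intro: less_imp_le)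
  have Mp: "p y \<le> M" if "y \<in> sphere 0 1" for y
    unfolding M_def using that assms(10) by (rule cSUP_upper)
  have i: "0 < i" "i \<le> M" using assms(9) ip[OF c] Mp[of c] c C by (auto simp: i_def)
  have w: "0 < omega TYPE('b)" by (rule omega_pos)
  have \<beta>: "0 < i / M" "i / M \<le> 1" using i by (simp_all add: divide_le_eq)
  \<comment> \<open>Together with \<beta> \<le> 1 this keeps the subtracted term at most 1/2, so
    \<rho> is positive.\<close>
  have "measure surf C \<le> pi * omega TYPE('b)"
    using surf.bounded_measure[of C] omega_le by (simp add: omega_def)
  then have "measure surf C / omega TYPE('b) \<le> pi" using w by (simp add: divide_le_eq)
  then have "i / M / (2 * pi) * (measure surf C / omega TYPE('b)) \<le> 1 / (2 * pi) * pi"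
    using \<beta> w by (intro mult_mono divide_right_mono) simp_all
  moreover have "0 < i / M / (2 * pi) * (measure surf C / omega TYPE('b))"
    using i w assms(8) by (intro mult_pos_pos divide_pos_pos) simp_all
  moreover have "1 / (2 * pi) * pi < (1::real)" by simp
  ultimately have \<rho>: "\<rho> \<in> {0<..<1}"
    unfolding \<rho>_def greaterThanLessThan_iff by linarith
  have "(SUP x \<in> sphere 0 1. tv (Hn TYPE('b) p n x) (target p)) \<le> \<rho> ^ n" for n
  proof (rule cSUP_least)
    show "sphere 0 1 \<noteq> ({} :: 'a set)" using c C by blast
    fix x :: 'a assume "x \<in> sphere 0 1"
    then have x: "norm x = 1" by simp
    have H: "Hn TYPE('b) p n x = Hn TYPE('b) q n x"
      by (rule Hn_cong[OF _ x]) (simp add: pq)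
    have "integrable surf q" "0 < integral\<^sup>L surf q"
      using int_q assms(5,6) by simp_all
    then have bound: "\<bar>measure (Hn TYPE('b) q n x) A - measure (target q) A\<bar> \<le> \<rho> ^ n" if "A \<in> sets sph_space" for A
      using Hn_convergence[of C i M \<rho> x A n] assms(7) i ip Mp pq C \<rho> x that
      by (auto simp: \<rho>_def subset_iff)
    show "tv (Hn TYPE('b) p n x) (target p) \<le> \<rho> ^ n"
      unfolding tv_def H tq
    proof (rule cSUP_least)
      fix A assume "A \<in> sets (Hn TYPE('b) q n x)"
      then show "\<bar>measure (Hn TYPE('b) q n x) A - measure (target q) A\<bar> \<le> \<rho> ^ n"
        using Hn_prob(1)[OF x, of n] by (intro bound) (simp add: space_prob_algebra)
    qed auto
  qed
  then show ?thesis
    using \<beta> \<rho> unfolding Let_def i_def[symmetric] M_def[symmetric] \<rho>_def[symmetric] by simp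
qed

end
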